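(* Assume that, on the sector $\langle\widehat U,\widetilde U\rangle$, the functions $f_\alpha$, $\alpha=1,2$, satisfy $$\frac{\partial f_\alpha(x_i,y_j,U)}{\partial u_\alpha}\le c_\alpha(x_i,y_j),\qquad -\frac{\partial f_\alpha(x_i,y_j,U)}{\partial u_{\alpha'}}\ge 0,\qquad U\in\langle\widehat U,\widetilde U\rangle,\ (x_i,y_j)\in\overline\Omega^h,\ \alpha'\ne\alpha,\ \alpha=1,2,$$ where $c_\alpha$ are non-negative bounded functions on $\overline\Omega^h$, and where $\widetilde U=(\widetilde U_1,\widetilde U_2)$ and $\widehat U=(\widehat U_1,\widehat U_2)$ are, respectively, ordered upper and lower solutions of the nonlinear difference scheme (defined in the context). Then the upper sequence $\{\overline U^{(n)}_{\alpha,i}\}$ and the lower sequence $\{\underline U^{(n)}_{\alpha,i}\}$, $i=0,1,\dots,N_x$, $\alpha=1,2$, generated by the block Gauss--Seidel method (defined in the context) with $\overline U^{(0)}=\widetilde U$ and $\underline U^{(0)}=\widehat U$ respectively, converge monotonically, respectively, from above to a maximal solution $\overline U$ and from below to a minimal solution $\underline U$ of the nonlinear difference scheme, such that for all $n\ge1$ $$\underline U^{(n-1)}_{\alpha,i}\le\underline U^{(n)}_{\alpha,i}\le\underline U_{\alpha,i}\le\overline U_{\alpha,i}\le\overline U^{(n)}_{\alpha,i}\le\overline U^{(n-1)}_{\alpha,i},\qquad i=0,1,\dots,N_x,\ \alpha=1,2.$$ If $S=(S_1,S_2)$ is any other solution of the nonlinear difference scheme in $\langle\widehat U,\widetilde U\rangle$,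 then $\underline U\le S\le\overline U$ in $\overline\Omega^h$.
   Context: Let $\omega=(0,1)\times(0,1)$, let $\varepsilon_1,\varepsilon_2>0$ be constants, and let $v_\alpha(x,y)\ge0$ on $\overline\omega$, $f_\alpha(x,y,u)$ with $u=(u_1,u_2)$, and $g=(g_1,g_2)$ (boundary data), $\alpha=1,2$, be smooth functions. All inequalities between vectors, vector functions and matrices are understood componentwise (entrywise). Mesh: $\overline\Omega^h=\{(x_i,y_j):0\le i\le N_x,\ 0\le j\le N_y\}$ with $x_i=ih_x$, $y_j=jh_y$, $h_x=1/N_x$, $h_y=1/N_y$; $\Omega^h$ is the set of interior mesh points ($1\le i\le N_x-1$, $1\le j\le N_y-1$) and $\partial\Omega^h=\overline\Omega^h\setminus\Omega^h$. For a mesh function $U=(U_1,U_2)$ put $U_{\alpha,ij}=U_\alpha(x_i,y_j)$. For an interior mesh point define $$\mathcal L_{\alpha,ij}U_\alpha(x_i,y_j)=-\varepsilon_\alpha\left(\frac{U_{\alpha,i-1,j}-2U_{\alpha,ij}+U_{\alpha,i+1,j}}{h_x^2}+\frac{U_{\alpha,i,j-1}-2U_{\alpha,ij}+U_{\alpha,i,j+1}}{h_y^2}\right)+v_\alpha(x_i,y_j)\left(\frac{U_{\alpha,ij}-U_{\alpha,i-1,j}}{h_x}+\frac{U_{\alpha,ij}-U_{\alpha,i,j-1}}{h_y}\right).$$ The nonlinear difference scheme is $$\mathcal L_{\alpha,ij}U_\alpha(x_i,y_j)+f_\alpha(x_i,y_j,U)=0,\ (x_i,y_j)\in\Omega^h,\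 \alpha=1,2;\qquad U(x_i,y_j)=g(x_i,y_j),\ (x_i,y_j)\in\partial\Omega^h.$$ Mesh functions $\widetilde U=(\widetilde U_1,\widetilde U_2)$ and $\widehat U=(\widehat U_1,\widehat U_2)$ are ordered upper and lower solutions of this scheme if $\widetilde U\ge\widehat U$ on $\overline\Omega^h$; $\mathcal L_{\alpha,ij}\widetilde U_\alpha(x_i,y_j)+f_\alpha(x_i,y_j,\widetilde U)\ge0$ and $\mathcal L_{\alpha,ij}\widehat U_\alpha(x_i,y_j)+f_\alpha(x_i,y_j,\widehat U)\le0$ on $\Omega^h$ for $\alpha=1,2$; and $\widehat U\le g\le\widetilde U$ on $\partial\Omega^h$. The sector is $\langle\widehat U,\widetilde U\rangle=\{U:\widehat U\le U\le\widetilde U\text{ on }\overline\Omega^h\}$. A maximal (minimal) solution is meant relative to the sector: a solution that is $\ge$ ($\le$) every solution in the sector. Block form. Put $l_{\alpha,ij}=\varepsilon_\alpha/h_x^2+v_\alpha(x_i,y_j)/h_x$, $r_{\alpha,ij}=\varepsilon_\alpha/h_x^2$, $b_{\alpha,ij}=\varepsilon_\alpha/h_y^2+v_\alpha(x_i,y_j)/h_y$, $t_{\alpha,ij}=\varepsilon_\alpha/h_y^2$, $d_{\alpha,ij}=l_{\alpha,ij}+r_{\alpha,ij}+b_{\alpha,ij}+t_{\alpha,ij}$. For $i=0,\dots,N_x$ let $U_{\alpha,i}=(U_{\alpha,i,1},\dots,U_{\alpha,i,N_y-1})^T$, $U_i=(U_{1,i},U_{2,i})$ and $g_{\alpha,i}=(g_\alpha(x_i,y_1),\dots,g_\alpha(x_i,y_{N_y-1}))^T$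 (for $i=0,N_x$). For $1\le i\le N_x-1$ let $L_{\alpha,i}=\mathrm{diag}(l_{\alpha,i,1},\dots,l_{\alpha,i,N_y-1})$, $R_{\alpha,i}=\mathrm{diag}(r_{\alpha,i,1},\dots,r_{\alpha,i,N_y-1})$, $C_{\alpha,i}=\mathrm{diag}(c_\alpha(x_i,y_1),\dots,c_\alpha(x_i,y_{N_y-1}))$ with $c_\alpha$ the functions bounding $\partial f_\alpha/\partial u_\alpha$; let $A_{\alpha,i}$ be the tridiagonal matrix with diagonal entries $d_{\alpha,ij}$ in row $j$, subdiagonal entries $-b_{\alpha,ij}$ in row $j$ ($j=2,\dots,N_y-1$), and superdiagonal entries $-t_{\alpha,ij}$ in row $j$ ($j=1,\dots,N_y-2$); let $F_{\alpha,i}(U_i)$ be the vector with entries $f_\alpha(x_i,y_j,U_{1,ij},U_{2,ij})$, $j=1,\dots,N_y-1$; and let $G^*_{\alpha,i}$ be the vector of boundary contributions from $y=0$ and $y=1$, i.e. with $b_{\alpha,i,1}g_\alpha(x_i,0)$ added to its first entry and $t_{\alpha,i,N_y-1}g_\alpha(x_i,1)$ added to its last entry, all other contributions being zero. The difference scheme is then $\mathcal K_{\alpha,i}(U_i)=\mathbf 0$ for $1\le i\le N_x-1$, with $U_{\alpha,i}=g_{\alpha,i}$ for $i=0,N_x$, where the residual is $$\mathcal K_{\alpha,i}(U_i)=A_{\alpha,i}U_{\alpha,i}-L_{\alpha,i}U_{\alpha,i-1}-R_{\alpha,i}U_{\alpha,i+1}+F_{\alpha,i}(U_i)-G^*_{\alpha,i}.$$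 Block Gauss--Seidel method: given $U^{(0)}$, for $n\ge1$ and $\alpha=1,2$ set $U^{(n)}_{\alpha,i}=U^{(n-1)}_{\alpha,i}+Z^{(n)}_{\alpha,i}$, where $$A_{\alpha,i}Z^{(n)}_{\alpha,i}-L_{\alpha,i}Z^{(n)}_{\alpha,i-1}+C_{\alpha,i}Z^{(n)}_{\alpha,i}=-\mathcal K_{\alpha,i}(U^{(n-1)}_i),\quad i=1,\dots,N_x-1,$$ and for $i=0,N_x$: $Z^{(1)}_{\alpha,i}=g_{\alpha,i}-U^{(0)}_{\alpha,i}$ and $Z^{(n)}_{\alpha,i}=\mathbf 0$ for $n\ge2$. On the mesh lines $y=0$ and $y=1$ the iterates $U^{(n)}$, $n\ge1$, are taken equal to $g$. *)

theory Defs
  imports "HOL-Analysis.Analysis" "Jordan_Normal_Form.Matrix"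
begin

(* Both HOL-Analysis and Jordan_Normal_Form declare a type "vec" and the infix $.
   Below, the infix $ and the unqualified names vec and mat are avoided: vec_nth and \<chi> belong
   to real ^ 2 (the values u = (u_1, u_2)), while Matrix.vec and Matrix.mat build the
   block vectors and matrices, whose dimension Ny - 1 is a term. *)


(* The index alpha ranges over the two-element type 2. *)

primrec Ck_on :: "nat \<Rightarrow> 'a::euclidean_space set \<Rightarrow> ('a \<Rightarrow> real) \<Rightarrow> bool" where
  "Ck_on 0 T \<phi> \<longleftrightarrow> continuous_on T \<phi>"
| "Ck_on (Suc k) T \<phi> \<longleftrightarrow>
     (\<forall>p\<in>T. \<phi> differentiable (at p)) \<and>
     (\<forall>b\<in>Basis. Ck_on k T (\<lambda>p. frechet_derivative \<phi> (at p) b))"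

(* Smoothness on a set that need not be open: restriction of a C-infinity function
   defined on an open neighbourhood. *)
definition smooth_on :: "'a::euclidean_space set \<Rightarrow> ('a \<Rightarrow> real) \<Rightarrow> bool" where
  "smooth_on S \<phi> \<longleftrightarrow>
     (\<exists>T \<psi>. open T \<and> S \<subseteq> T \<and> (\<forall>k. Ck_on k T \<psi>) \<and> (\<forall>p\<in>S. \<phi> p = \<psi> p))"

definition omega :: "(real \<times> real) set" where
  "omega = {0<..<1} \<times> {0<..<1}"

definition partial_deriv :: "(real ^ 2 \<Rightarrow> real) \<Rightarrow> 2 \<Rightarrow> real ^ 2 \<Rightarrow> real" where
  "partial_deriv \<phi> \<beta> u =
     deriv (\<lambda>s. \<phi> (\<chi> \<gamma>. if \<gamma> = \<beta> then s else vec_nth u \<gamma>)) (vec_nth u \<beta>)"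


definition mesh_step :: "nat \<Rightarrow> real" where
  "mesh_step N = 1 / real N"

definition node :: "nat \<Rightarrow> nat \<Rightarrow> real" where
  "node N i = real i * mesh_step N"

(* The mesh point (node Nx i, node Ny j) is represented by its index pair (i, j), and a mesh
   function U by U \<alpha> i j = U_alpha(x_i, y_j); only its values at (i, j) in
   closed_mesh Nx Ny are meaningful. *)
type_synonym mesh_fun = "2 \<Rightarrow> nat \<Rightarrow> nat \<Rightarrow> real"

definition closed_mesh :: "nat \<Rightarrow> nat \<Rightarrow> (nat \<times> nat) set" where
  "closed_mesh Nx Ny = {..Nx} \<times> {..Ny}"

definition interior_mesh :: "nat \<Rightarrow> nat \<Rightarrow> (nat \<times> nat) set" where
  "interior_mesh Nx Ny = {1..Nx - 1} \<times> {1..Ny - 1}"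

definition boundary_mesh :: "nat \<Rightarrow> nat \<Rightarrow> (nat \<times> nat) set" where
  "boundary_mesh Nx Ny = closed_mesh Nx Ny - interior_mesh Nx Ny"

definition mesh_val :: "mesh_fun \<Rightarrow> nat \<Rightarrow> nat \<Rightarrow> real ^ 2" where
  "mesh_val U i j = (\<chi> \<alpha>. U \<alpha> i j)"

definition mesh_le :: "nat \<Rightarrow> nat \<Rightarrow> mesh_fun \<Rightarrow> mesh_fun \<Rightarrow> bool" where
  "mesh_le Nx Ny U W \<longleftrightarrow> (\<forall>\<alpha>. \<forall>(i, j)\<in>closed_mesh Nx Ny. U \<alpha> i j \<le> W \<alpha> i j)"

definition sector :: "nat \<Rightarrow> nat \<Rightarrow> mesh_fun \<Rightarrow> mesh_fun \<Rightarrow> mesh_fun set" where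
  "sector Nx Ny Ulow Uup = {U. mesh_le Nx Ny Ulow U \<and> mesh_le Nx Ny U Uup}"


definition diff_op ::
  "nat \<Rightarrow> nat \<Rightarrow> (2 \<Rightarrow> real) \<Rightarrow> (2 \<Rightarrow> real \<Rightarrow> real \<Rightarrow> real) \<Rightarrow>
   2 \<Rightarrow> (nat \<Rightarrow> nat \<Rightarrow> real) \<Rightarrow> nat \<Rightarrow> nat \<Rightarrow> real"
where
  "diff_op Nx Ny eps v \<alpha> W i j =
     - eps \<alpha> * ((W (i - 1) j - 2 * W i j + W (i + 1) j) / (mesh_step Nx)\<^sup>2
              + (W i (j - 1) - 2 * W i j + W i (j + 1)) / (mesh_step Ny)\<^sup>2)
     + v \<alpha> (node Nx i) (node Ny j) *
         ((W i j - W (i - 1) j) / mesh_step Nx + (W i j - W i (j - 1)) / mesh_step Ny)"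

definition scheme_lhs ::
  "nat \<Rightarrow> nat \<Rightarrow> (2 \<Rightarrow> real) \<Rightarrow> (2 \<Rightarrow> real \<Rightarrow> real \<Rightarrow> real) \<Rightarrow>
   (2 \<Rightarrow> real \<Rightarrow> real \<Rightarrow> real ^ 2 \<Rightarrow> real) \<Rightarrow> 2 \<Rightarrow> mesh_fun \<Rightarrow> nat \<Rightarrow> nat \<Rightarrow> real"
where
  "scheme_lhs Nx Ny eps v f \<alpha> U i j =
     diff_op Nx Ny eps v \<alpha> (U \<alpha>) i j + f \<alpha> (node Nx i) (node Ny j) (mesh_val U i j)"

definition scheme_solution ::
  "nat \<Rightarrow> nat \<Rightarrow> (2 \<Rightarrow> real) \<Rightarrow> (2 \<Rightarrow> real \<Rightarrow> real \<Rightarrow> real) \<Rightarrow>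
   (2 \<Rightarrow> real \<Rightarrow> real \<Rightarrow> real ^ 2 \<Rightarrow> real) \<Rightarrow> (2 \<Rightarrow> real \<Rightarrow> real \<Rightarrow> real) \<Rightarrow> mesh_fun \<Rightarrow> bool"
where
  "scheme_solution Nx Ny eps v f g U \<longleftrightarrow>
     (\<forall>\<alpha>. \<forall>(i, j)\<in>interior_mesh Nx Ny. scheme_lhs Nx Ny eps v f \<alpha> U i j = 0) \<and>
     (\<forall>\<alpha>. \<forall>(i, j)\<in>boundary_mesh Nx Ny. U \<alpha> i j = g \<alpha> (node Nx i) (node Ny j))"

definition ordered_upper_lower ::
  "nat \<Rightarrow> nat \<Rightarrow> (2 \<Rightarrow> real) \<Rightarrow> (2 \<Rightarrow> real \<Rightarrow> real \<Rightarrow> real) \<Rightarrow>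
   (2 \<Rightarrow> real \<Rightarrow> real \<Rightarrow> real ^ 2 \<Rightarrow> real) \<Rightarrow> (2 \<Rightarrow> real \<Rightarrow> real \<Rightarrow> real) \<Rightarrow>
   mesh_fun \<Rightarrow> mesh_fun \<Rightarrow> bool"
where
  "ordered_upper_lower Nx Ny eps v f g Uup Ulow \<longleftrightarrow>
     mesh_le Nx Ny Ulow Uup \<and>
     (\<forall>\<alpha>. \<forall>(i, j)\<in>interior_mesh Nx Ny.
        scheme_lhs Nx Ny eps v f \<alpha> Uup i j \<ge> 0 \<and> scheme_lhs Nx Ny eps v f \<alpha> Ulow i j \<le> 0) \<and>
     (\<forall>\<alpha>. \<forall>(i, j)\<in>boundary_mesh Nx Ny.
        Ulow \<alpha> i j \<le> g \<alpha> (node Nx i) (node Ny j) \<and> g \<alpha> (node Nx i) (node Ny j) \<le> Uup \<alpha> i j)"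

definition maximal_solution ::
  "nat \<Rightarrow> nat \<Rightarrow> (2 \<Rightarrow> real) \<Rightarrow> (2 \<Rightarrow> real \<Rightarrow> real \<Rightarrow> real) \<Rightarrow>
   (2 \<Rightarrow> real \<Rightarrow> real \<Rightarrow> real ^ 2 \<Rightarrow> real) \<Rightarrow> (2 \<Rightarrow> real \<Rightarrow> real \<Rightarrow> real) \<Rightarrow>
   mesh_fun set \<Rightarrow> mesh_fun \<Rightarrow> bool"
where
  "maximal_solution Nx Ny eps v f g Sec U \<longleftrightarrow>
     scheme_solution Nx Ny eps v f g U \<and>
     (\<forall>S\<in>Sec. scheme_solution Nx Ny eps v f g S \<longrightarrow> mesh_le Nx Ny S U)"

definition minimal_solution ::
  "nat \<Rightarrow> nat \<Rightarrow> (2 \<Rightarrow> real) \<Rightarrow> (2 \<Rightarrow> real \<Rightarrow> real \<Rightarrow> real) \<Rightarrow>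
   (2 \<Rightarrow> real \<Rightarrow> real \<Rightarrow> real ^ 2 \<Rightarrow> real) \<Rightarrow> (2 \<Rightarrow> real \<Rightarrow> real \<Rightarrow> real) \<Rightarrow>
   mesh_fun set \<Rightarrow> mesh_fun \<Rightarrow> bool"
where
  "minimal_solution Nx Ny eps v f g Sec U \<longleftrightarrow>
     scheme_solution Nx Ny eps v f g U \<and>
     (\<forall>S\<in>Sec. scheme_solution Nx Ny eps v f g S \<longrightarrow> mesh_le Nx Ny U S)"


definition coef_l ::
  "nat \<Rightarrow> nat \<Rightarrow> (2 \<Rightarrow> real) \<Rightarrow> (2 \<Rightarrow> real \<Rightarrow> real \<Rightarrow> real) \<Rightarrow> 2 \<Rightarrow> nat \<Rightarrow> nat \<Rightarrow> real" where
  "coef_l Nx Ny eps v \<alpha> i j =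
     eps \<alpha> / (mesh_step Nx)\<^sup>2 + v \<alpha> (node Nx i) (node Ny j) / mesh_step Nx"

definition coef_r :: "nat \<Rightarrow> (2 \<Rightarrow> real) \<Rightarrow> 2 \<Rightarrow> nat \<Rightarrow> nat \<Rightarrow> real" where
  "coef_r Nx eps \<alpha> i j = eps \<alpha> / (mesh_step Nx)\<^sup>2"

definition coef_b ::
  "nat \<Rightarrow> nat \<Rightarrow> (2 \<Rightarrow> real) \<Rightarrow> (2 \<Rightarrow> real \<Rightarrow> real \<Rightarrow> real) \<Rightarrow> 2 \<Rightarrow> nat \<Rightarrow> nat \<Rightarrow> real" where
  "coef_b Nx Ny eps v \<alpha> i j =
     eps \<alpha> / (mesh_step Ny)\<^sup>2 + v \<alpha> (node Nx i) (node Ny j) / mesh_step Ny"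

definition coef_t :: "nat \<Rightarrow> (2 \<Rightarrow> real) \<Rightarrow> 2 \<Rightarrow> nat \<Rightarrow> nat \<Rightarrow> real" where
  "coef_t Ny eps \<alpha> i j = eps \<alpha> / (mesh_step Ny)\<^sup>2"

definition coef_d ::
  "nat \<Rightarrow> nat \<Rightarrow> (2 \<Rightarrow> real) \<Rightarrow> (2 \<Rightarrow> real \<Rightarrow> real \<Rightarrow> real) \<Rightarrow> 2 \<Rightarrow> nat \<Rightarrow> nat \<Rightarrow> real" where
  "coef_d Nx Ny eps v \<alpha> i j =
     coef_l Nx Ny eps v \<alpha> i j + coef_r Nx eps \<alpha> i j
     + coef_b Nx Ny eps v \<alpha> i j + coef_t Ny eps \<alpha> i j"

(* Block vectors and matrices are indexed from 0: entry k belongs to the mesh index j = k + 1. *)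

definition line :: "nat \<Rightarrow> mesh_fun \<Rightarrow> 2 \<Rightarrow> nat \<Rightarrow> real Matrix.vec" where
  "line Ny U \<alpha> i = Matrix.vec (Ny - 1) (\<lambda>k. U \<alpha> i (k + 1))"

definition g_line ::
  "nat \<Rightarrow> nat \<Rightarrow> (2 \<Rightarrow> real \<Rightarrow> real \<Rightarrow> real) \<Rightarrow> 2 \<Rightarrow> nat \<Rightarrow> real Matrix.vec" where
  "g_line Nx Ny g \<alpha> i = Matrix.vec (Ny - 1) (\<lambda>k. g \<alpha> (node Nx i) (node Ny (k + 1)))"

definition L_block ::
  "nat \<Rightarrow> nat \<Rightarrow> (2 \<Rightarrow> real) \<Rightarrow> (2 \<Rightarrow> real \<Rightarrow> real \<Rightarrow> real) \<Rightarrow> 2 \<Rightarrow> nat \<Rightarrow> real Matrix.mat" where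
  "L_block Nx Ny eps v \<alpha> i = mat_diag (Ny - 1) (\<lambda>k. coef_l Nx Ny eps v \<alpha> i (k + 1))"

definition R_block :: "nat \<Rightarrow> nat \<Rightarrow> (2 \<Rightarrow> real) \<Rightarrow> 2 \<Rightarrow> nat \<Rightarrow> real Matrix.mat" where
  "R_block Nx Ny eps \<alpha> i = mat_diag (Ny - 1) (\<lambda>k. coef_r Nx eps \<alpha> i (k + 1))"

definition C_block :: "nat \<Rightarrow> mesh_fun \<Rightarrow> 2 \<Rightarrow> nat \<Rightarrow> real Matrix.mat" where
  "C_block Ny c \<alpha> i = mat_diag (Ny - 1) (\<lambda>k. c \<alpha> i (k + 1))"

definition A_block ::
  "nat \<Rightarrow> nat \<Rightarrow> (2 \<Rightarrow> real) \<Rightarrow> (2 \<Rightarrow> real \<Rightarrow> real \<Rightarrow> real) \<Rightarrow> 2 \<Rightarrow> nat \<Rightarrow> real Matrix.mat" where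
  "A_block Nx Ny eps v \<alpha> i =
     Matrix.mat (Ny - 1) (Ny - 1) (\<lambda>(p, q).
       if q = p then coef_d Nx Ny eps v \<alpha> i (p + 1)
       else if q + 1 = p then - coef_b Nx Ny eps v \<alpha> i (p + 1)
       else if q = p + 1 then - coef_t Ny eps \<alpha> i (p + 1)
       else 0)"

definition F_block ::
  "nat \<Rightarrow> nat \<Rightarrow> (2 \<Rightarrow> real \<Rightarrow> real \<Rightarrow> real ^ 2 \<Rightarrow> real) \<Rightarrow> mesh_fun \<Rightarrow> 2 \<Rightarrow> nat \<Rightarrow> real Matrix.vec"
where
  "F_block Nx Ny f U \<alpha> i =
     Matrix.vec (Ny - 1) (\<lambda>k. f \<alpha> (node Nx i) (node Ny (k + 1)) (mesh_val U i (k + 1)))"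

(* If Ny = 2, the only entry is both first and last and receives both contributions. *)
definition G_block ::
  "nat \<Rightarrow> nat \<Rightarrow> (2 \<Rightarrow> real) \<Rightarrow> (2 \<Rightarrow> real \<Rightarrow> real \<Rightarrow> real) \<Rightarrow>
   (2 \<Rightarrow> real \<Rightarrow> real \<Rightarrow> real) \<Rightarrow> 2 \<Rightarrow> nat \<Rightarrow> real Matrix.vec"
where
  "G_block Nx Ny eps v g \<alpha> i =
     Matrix.vec (Ny - 1) (\<lambda>k.
       (if k + 1 = 1 then coef_b Nx Ny eps v \<alpha> i 1 * g \<alpha> (node Nx i) 0 else 0)
       + (if k + 1 = Ny - 1 then coef_t Ny eps \<alpha> i (Ny - 1) * g \<alpha> (node Nx i) 1 else 0))"

definition residual ::
  "nat \<Rightarrow> nat \<Rightarrow> (2 \<Rightarrow> real) \<Rightarrow> (2 \<Rightarrow> real \<Rightarrow> real \<Rightarrow> real) \<Rightarrow>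
   (2 \<Rightarrow> real \<Rightarrow> real \<Rightarrow> real ^ 2 \<Rightarrow> real) \<Rightarrow> (2 \<Rightarrow> real \<Rightarrow> real \<Rightarrow> real) \<Rightarrow>
   mesh_fun \<Rightarrow> 2 \<Rightarrow> nat \<Rightarrow> real Matrix.vec"
where
  "residual Nx Ny eps v f g U \<alpha> i =
     A_block Nx Ny eps v \<alpha> i *\<^sub>v line Ny U \<alpha> i
     - L_block Nx Ny eps v \<alpha> i *\<^sub>v line Ny U \<alpha> (i - 1)
     - R_block Nx Ny eps \<alpha> i *\<^sub>v line Ny U \<alpha> (i + 1)
     + F_block Nx Ny f U \<alpha> i
     - G_block Nx Ny eps v g \<alpha> i"

(* U n is the n-th iterate; the initial iterate U 0 is arbitrary here. *)
definition block_gauss_seidel ::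
  "nat \<Rightarrow> nat \<Rightarrow> (2 \<Rightarrow> real) \<Rightarrow> (2 \<Rightarrow> real \<Rightarrow> real \<Rightarrow> real) \<Rightarrow>
   (2 \<Rightarrow> real \<Rightarrow> real \<Rightarrow> real ^ 2 \<Rightarrow> real) \<Rightarrow> (2 \<Rightarrow> real \<Rightarrow> real \<Rightarrow> real) \<Rightarrow>
   mesh_fun \<Rightarrow> (nat \<Rightarrow> mesh_fun) \<Rightarrow> bool"
where
  "block_gauss_seidel Nx Ny eps v f g c U \<longleftrightarrow>
     (\<exists>Z :: nat \<Rightarrow> 2 \<Rightarrow> nat \<Rightarrow> real Matrix.vec. \<forall>n\<ge>1. \<forall>\<alpha>.
        (\<forall>i\<le>Nx. Z n \<alpha> i \<in> carrier_vec (Ny - 1) \<and>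
           line Ny (U n) \<alpha> i = line Ny (U (n - 1)) \<alpha> i + Z n \<alpha> i) \<and>
        (\<forall>i\<in>{1..Nx - 1}.
           A_block Nx Ny eps v \<alpha> i *\<^sub>v Z n \<alpha> i - L_block Nx Ny eps v \<alpha> i *\<^sub>v Z n \<alpha> (i - 1)
             + C_block Ny c \<alpha> i *\<^sub>v Z n \<alpha> i
           = - residual Nx Ny eps v f g (U (n - 1)) \<alpha> i) \<and>
        (\<forall>i\<in>{0, Nx}. Z n \<alpha> i =
           (if n = 1 then g_line Nx Ny g \<alpha> i - line Ny (U 0) \<alpha> i else 0\<^sub>v (Ny - 1))) \<and>
        (\<forall>i\<le>Nx. \<forall>j\<in>{0, Ny}. U n \<alpha> i j = g \<alpha> (node Nx i) (node Ny j)))"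

definition mesh_converges :: "nat \<Rightarrow> nat \<Rightarrow> (nat \<Rightarrow> mesh_fun) \<Rightarrow> mesh_fun \<Rightarrow> bool" where
  "mesh_converges Nx Ny U W \<longleftrightarrow>
     (\<forall>\<alpha>. \<forall>(i, j)\<in>closed_mesh Nx Ny. (\<lambda>n. U n \<alpha> i j) \<longlonglongrightarrow> W \<alpha> i j)"

end

theory Submission
  imports Defs
begin

text \<open>
  In terms of the new iterate \<open>U'\<close>, one sweep is \<open>P U' = \<Phi> U\<close> in the interior and \<open>U' = g\<close> on the
  boundary: \<open>P\<close> collects the diagonal \<open>d + c\<close> and the neighbours with weights \<open>- l\<close>, \<open>- b\<close>, \<open>- t\<close>,
  while \<open>\<Phi> U\<close> collects the right neighbour with weight \<open>r\<close> and the term \<open>c U - f(U)\<close>.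
  Since \<open>d = l + r + b + t\<close> with \<open>r > 0\<close>, \<open>P\<close> is strictly diagonally dominant, hence solvable and
  inverse monotone; the derivative bounds make \<open>\<Phi>\<close> increasing on the sector. So the sweep is an increasing
  self-map of the sector whose fixed points are the solutions of the scheme, and the iterates of the
  upper (lower) solution decrease (increase) to the largest (smallest) fixed point.
\<close>

section \<open>Solvability of strictly diagonally dominant systems\<close>

text \<open>Gaussian elimination by induction on the index set: removing one unknown preserves
  nonnegative weights and strict dominance. The weights may have a diagonal part
  \<open>a p p\<close>, so the diagonal fill-in of an elimination goes into \<open>a\<close> while
  \<open>D\<close> stays fixed.\<close>

lemma diagonally_dominant_solvable:
  fixes a :: "'a \<Rightarrow> 'a \<Rightarrow> real"
  assumes "finite I"
    and "\<And>p q. p \<in> I \<Longrightarrow> q \<in> I \<Longrightarrow> a p q \<ge> 0"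
    and "\<And>p. p \<in> I \<Longrightarrow> (\<Sum>q\<in>I. a p q) < D p"
  shows "\<exists>x. \<forall>p\<in>I. D p * x p = (\<Sum>q\<in>I. a p q * x q) + y p"
  using assms
proof (induction I arbitrary: a y rule: finite_induct)
  case empty
  then show ?case by simp
next
  case (insert k I)
  define e where "e = D k - a k k"
  define s where "s = (\<Sum>q\<in>I. a k q)"
  \<comment> \<open>Dominance of row \<open>k\<close> bounds its weights towards the other unknowns
    by the pivot \<open>e\<close>, which is therefore positive.\<close>
  have s: "0 \<le> s" "s < e"
    using insert.prems(2)[of k] insert.hyps insert.prems(1)
    by (auto simp: s_def e_def intro!: sum_nonneg)
  \<comment> \<open>Solving row \<open>k\<close> for its own unknown and inserting the result into
    row \<open>p\<close> gives these weights and data.\<close>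
  define a' where "a' p q = a p q + a p k * a k q / e" for p q
  define y' where "y' p = y p + a p k * y k / e" for p
  have row: "(\<Sum>q\<in>I. a' p q) < D p" if p: "p \<in> I" for p
  proof -
    have "(\<Sum>q\<in>I. a' p q) = (\<Sum>q\<in>I. a p q) + a p k * (s / e)"
      by (simp add: a'_def s_def sum.distrib sum_distrib_left sum_divide_distrib)
    \<comment> \<open>The eliminated weight \<open>a p k\<close> returns only with the factor
      \<open>s / e\<close>, which is at most 1.\<close>
    also have "\<dots> \<le> (\<Sum>q\<in>I. a p q) + a p k"
      using mult_left_le[of "s / e" "a p k"] s p insert.prems(1) by (simp del: times_divide_eq_right)
    also have "\<dots> < D p"
      using insert.prems(2)[of p] p insert.hyps by simp
    finally show ?thesis .
  qed
  have "a' p q \<ge> 0" if "p \<in> I" "q \<in> I" for p q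
    using that s insert.prems(1) by (simp add: a'_def)
  from insert.IH[OF this row, of y'] obtain x where
    x: "\<And>p. p \<in> I \<Longrightarrow> D p * x p = (\<Sum>q\<in>I. a' p q * x q) + y' p" by auto
  define X where "X = (\<Sum>q\<in>I. a k q * x q)"
  \<comment> \<open>Back substitution recovers the eliminated unknown.\<close>
  define z where "z = x(k := (y k + X) / e)"
  have zI: "(\<Sum>q\<in>I. a p q * z q) = (\<Sum>q\<in>I. a p q * x q)" for p
    using insert.hyps by (intro sum.cong) (auto simp: z_def)
  have "D p * z p = (\<Sum>q\<in>insert k I. a p q * z q) + y p" if "p \<in> insert k I" for p
  proof (cases "p = k")
    case True
    have "e * z k = y k + X" using s by (simp add: z_def)
    then show ?thesis
      using insert.hyps zI[of k] True by (simp add: e_def X_def algebra_simps)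
  next
    case False
    then have p: "p \<in> I" and "z p = x p" using that by (auto simp: z_def)
    have "(\<Sum>q\<in>I. a' p q * x q) = (\<Sum>q\<in>I. a p q * x q) + a p k * X / e"
      by (simp add: a'_def X_def sum.distrib sum_distrib_left sum_divide_distrib algebra_simps)
    with x[OF p] \<open>z p = x p\<close> show ?thesis
      using insert.hyps zI[of p]
      by (simp add: y'_def z_def add_divide_distrib algebra_simps)
  qed
  then show ?case by blast
qed

section \<open>Monotonicity of the nonlinearity from its partial derivatives\<close>

text \<open>Mean value theorem on the segment from \<open>u\<close> to \<open>w\<close>. The segment
  stays in the box between its ends, and \<open>w - u\<close> is nonnegative, so in the product of
  the gradient with \<open>w - u\<close> only the term of index \<open>\<alpha>\<close> can be
  positive, and \<open>K\<close> bounds its derivative.\<close>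

lemma mono_along_segment:
  fixes \<phi> :: "real ^ 2 \<Rightarrow> real"
  assumes diff: "\<And>u. \<phi> differentiable (at u)"
    and le: "\<And>\<gamma>. vec_nth u \<gamma> \<le> vec_nth w \<gamma>"
    and diag: "\<And>p. (\<And>\<gamma>. vec_nth u \<gamma> \<le> vec_nth p \<gamma> \<and> vec_nth p \<gamma> \<le> vec_nth w \<gamma>) \<Longrightarrow>
      partial_deriv \<phi> \<alpha> p \<le> K"
    and off: "\<And>p \<beta>. (\<And>\<gamma>. vec_nth u \<gamma> \<le> vec_nth p \<gamma> \<and> vec_nth p \<gamma> \<le> vec_nth w \<gamma>) \<Longrightarrow>
      \<beta> \<noteq> \<alpha> \<Longrightarrow> partial_deriv \<phi> \<beta> p \<le> 0"
  shows "\<phi> w - \<phi> u \<le> K * (vec_nth w \<alpha> - vec_nth u \<alpha>)"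
proof -
  \<comment> \<open>Replacing coordinate \<open>\<beta>\<close> by \<open>s\<close> is a motion
    along the direction \<open>axis \<beta> 1\<close>, so the chain rule turns the one-variable
    derivative into a value of the Frechet derivative.\<close>
  have partial: "partial_deriv \<phi> \<beta> p = frechet_derivative \<phi> (at p) (axis \<beta> 1)" for \<beta> p
  proof -
    have "((\<lambda>s. \<phi> (p + (s - vec_nth p \<beta>) *\<^sub>R axis \<beta> 1)) has_derivative
        (\<lambda>h. frechet_derivative \<phi> (at p) (h *\<^sub>R axis \<beta> 1))) (at (vec_nth p \<beta>))"
    proof (rule has_derivative_compose[where g = \<phi>])
      show "((\<lambda>s. p + (s - vec_nth p \<beta>) *\<^sub>R axis \<beta> 1) has_derivative (\<lambda>h. h *\<^sub>R axis \<beta> 1))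
          (at (vec_nth p \<beta>))"
        by (auto intro!: derivative_eq_intros)
      show "(\<phi> has_derivative frechet_derivative \<phi> (at p))
          (at (p + (vec_nth p \<beta> - vec_nth p \<beta>) *\<^sub>R axis \<beta> 1))"
        using diff frechet_derivative_works[of \<phi> "at p"] by simp
    qed
    moreover have "p + (s - vec_nth p \<beta>) *\<^sub>R axis \<beta> 1
        = (\<chi> \<gamma>. if \<gamma> = \<beta> then s else vec_nth p \<gamma>)" for s
      by (auto simp: Finite_Cartesian_Product.vec_eq_iff axis_def)
    moreover have "frechet_derivative \<phi> (at p) (h *\<^sub>R axis \<beta> 1)
        = frechet_derivative \<phi> (at p) (axis \<beta> 1) * h" for h
      using linear_scale[OF linear_frechet_derivative[OF diff[of p]]] by simp
    ultimately have "((\<lambda>s. \<phi> (\<chi> \<gamma>. if \<gamma> = \<beta> then s else vec_nth p \<gamma>)) has_real_derivative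
        frechet_derivative \<phi> (at p) (axis \<beta> 1)) (at (vec_nth p \<beta>))"
      by (simp add: has_field_derivative_def)
    then show ?thesis by (simp add: partial_deriv_def DERIV_imp_deriv)
  qed
  define q where "q s = u + s *\<^sub>R (w - u)" for s :: real
  have der: "((\<lambda>s. \<phi> (q s)) has_derivative (\<lambda>h. frechet_derivative \<phi> (at (q s)) (h *\<^sub>R (w - u)))) (at s within {0..1})"
    if "0 \<le> s" "s \<le> 1" for s
  proof (rule has_derivative_at_withinI, rule has_derivative_compose[where g = \<phi>])
    show "(q has_derivative (\<lambda>h. h *\<^sub>R (w - u))) (at s)"
      unfolding q_def by (auto intro!: derivative_eq_intros)
    show "(\<phi> has_derivative frechet_derivative \<phi> (at (q s))) (at (q s))"
      using diff frechet_derivative_works by blast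
  qed
  have "\<exists>s\<in>{0<..<1}. \<phi> (q 1) - \<phi> (q 0)
      = frechet_derivative \<phi> (at (q s)) ((1 - 0) *\<^sub>R (w - u))"
    by (rule mvt_simple) (simp, rule der)
  then obtain s where s: "0 < s" "s < 1"
    and eq: "\<phi> (q 1) - \<phi> (q 0) = frechet_derivative \<phi> (at (q s)) (w - u)"
    by auto
  have q: "vec_nth u \<gamma> \<le> vec_nth (q s) \<gamma> \<and> vec_nth (q s) \<gamma> \<le> vec_nth w \<gamma>" for \<gamma>
  proof -
    have "s * (vec_nth w \<gamma> - vec_nth u \<gamma>) \<le> vec_nth w \<gamma> - vec_nth u \<gamma>"
      using s le[of \<gamma>] by (intro mult_left_le_one_le) auto
    then show ?thesis using s le[of \<gamma>] by (simp add: q_def)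
  qed
  have lin: "linear (frechet_derivative \<phi> (at (q s)))"
    by (rule linear_frechet_derivative[OF diff])
  \<comment> \<open>Expanding \<open>w - u\<close> in unit vectors brings in the partial derivatives
    by linearity.\<close>
  have "frechet_derivative \<phi> (at (q s)) (w - u)
      = frechet_derivative \<phi> (at (q s)) (\<Sum>\<beta>\<in>UNIV. (vec_nth w \<beta> - vec_nth u \<beta>) *\<^sub>R axis \<beta> 1)"
    using basis_expansion[of "w - u"] by (simp add: scalar_mult_eq_scaleR)
  also have "\<dots> = (\<Sum>\<beta>\<in>UNIV. (vec_nth w \<beta> - vec_nth u \<beta>) * partial_deriv \<phi> \<beta> (q s))"
    by (simp add: linear_sum[OF lin] linear_scale[OF lin] partial)
  also have "\<dots> \<le> (\<Sum>\<beta>\<in>UNIV. if \<beta> = \<alpha> then K * (vec_nth w \<alpha> - vec_nth u \<alpha>) else 0)"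
  proof (intro sum_mono)
    fix \<beta> :: 2
    show "(vec_nth w \<beta> - vec_nth u \<beta>) * partial_deriv \<phi> \<beta> (q s)
        \<le> (if \<beta> = \<alpha> then K * (vec_nth w \<alpha> - vec_nth u \<alpha>) else 0)"
      using diag[OF q] off[OF q, of \<beta>] le[of \<beta>]
      by (auto simp: mult.commute[of K] mult_nonneg_nonpos intro!: mult_left_mono)
  qed
  finally show ?thesis using eq by (simp add: q_def)
qed

text \<open>Smoothness provides agreement with \<open>\<psi>\<close> only on
  \<open>S \<times> UNIV\<close>, but for fixed \<open>(x, y)\<close> the whole slice in
  \<open>u\<close> lies in that set. Hence differentiability in \<open>u\<close> carries over even
  when \<open>(x, y)\<close> is a boundary point of \<open>S\<close>.\<close>

lemma smooth_on_section:
  assumes "smooth_on (S \<times> UNIV) (\<lambda>((x, y), u). \<phi> x y u)" and "(x, y) \<in> S"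
  shows "\<phi> x y differentiable (at u)"
proof -
  obtain T \<psi> where T: "S \<times> UNIV \<subseteq> T" "\<forall>k. Ck_on k T \<psi>"
    and eq: "\<forall>p\<in>S \<times> UNIV. (\<lambda>((x, y), u). \<phi> x y u) p = \<psi> p"
    using assms(1)[unfolded smooth_on_def] by metis
  have "\<phi> x y = \<psi> \<circ> Pair (x, y)"
  proof
    fix u show "\<phi> x y u = (\<psi> \<circ> Pair (x, y)) u"
      using bspec[OF eq, of "((x, y), u)"] assms(2) by simp
  qed
  moreover have "\<psi> differentiable (at ((x, y), u))"
    using T(1) spec[OF T(2), of "Suc 0"] assms(2) by auto
  moreover have "Pair (x, y) differentiable (at u)"
    by (intro differentiableI[where f' = "\<lambda>h. (0, h)"]) (auto intro!: derivative_eq_intros)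
  ultimately show ?thesis by (simp add: differentiable_chain_at)
qed

section \<open>Mesh bookkeeping and limits of monotone mesh sequences\<close>

lemma all_ge_one_iff: "(\<forall>n\<ge>1. Q n) \<longleftrightarrow> (\<forall>n. Q (Suc n))"
  by (auto simp: Suc_le_eq gr0_conv_Suc)

lemma node_mem_unit: "i \<le> N \<Longrightarrow> node N i \<in> {0..1}"
  by (auto simp: node_def mesh_step_def divide_le_eq)

lemma closure_omega: "closure omega = {0..1} \<times> {0..1}"
  by (simp add: omega_def closure_Times)

lemma boundary_mesh_iff:
  "(i, j) \<in> boundary_mesh Nx Ny \<longleftrightarrow> i \<le> Nx \<and> j \<le> Ny \<and> (i = 0 \<or> i = Nx \<or> j = 0 \<or> j = Ny)"
  by (auto simp: boundary_mesh_def closed_mesh_def interior_mesh_def)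

lemma interior_mesh_iff: "(i, j) \<in> interior_mesh Nx Ny \<longleftrightarrow> 0 < i \<and> i < Nx \<and> 0 < j \<and> j < Ny"
  by (auto simp: interior_mesh_def)

lemma closed_mesh_iff: "(i, j) \<in> closed_mesh Nx Ny \<longleftrightarrow> i \<le> Nx \<and> j \<le> Ny"
  by (auto simp: closed_mesh_def)

lemma closed_mesh_cases:
  assumes "(i, j) \<in> closed_mesh Nx Ny"
  obtains "(i, j) \<in> interior_mesh Nx Ny" | "(i, j) \<in> boundary_mesh Nx Ny"
  using assms by (auto simp: boundary_mesh_def)

lemma mesh_leI:
  "(\<And>\<alpha> i j. (i, j) \<in> closed_mesh Nx Ny \<Longrightarrow> U \<alpha> i j \<le> W \<alpha> i j) \<Longrightarrow> mesh_le Nx Ny U W"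
  by (auto simp: mesh_le_def)

lemma mesh_leD:
  "mesh_le Nx Ny U W \<Longrightarrow> (i, j) \<in> closed_mesh Nx Ny \<Longrightarrow> U \<alpha> i j \<le> W \<alpha> i j"
  by (auto simp: mesh_le_def)

lemma mesh_le_refl: "mesh_le Nx Ny U U"
  by (auto intro: mesh_leI)

lemma mesh_le_line:
  "mesh_le Nx Ny U W \<Longrightarrow> i \<le> Nx \<Longrightarrow> line Ny U \<alpha> i \<le> line Ny W \<alpha> i"
  by (auto simp: line_def less_eq_vec_def mesh_le_def closed_mesh_def)

lemma mesh_convergesD:
  "mesh_converges Nx Ny U W \<Longrightarrow> (i, j) \<in> closed_mesh Nx Ny \<Longrightarrow> (\<lambda>n. U n \<alpha> i j) \<longlonglongrightarrow> W \<alpha> i j"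
  by (auto simp: mesh_converges_def)

lemma mesh_le_limit_const:
  assumes "mesh_converges Nx Ny U W" and "\<And>n. mesh_le Nx Ny V (U n)"
  shows "mesh_le Nx Ny V W"
proof (rule mesh_leI)
  fix \<alpha> i j assume "(i, j) \<in> closed_mesh Nx Ny"
  then show "V \<alpha> i j \<le> W \<alpha> i j"
    using LIMSEQ_le_const[OF mesh_convergesD[OF assms(1)]] assms(2) by (meson mesh_leD)
qed

lemma mesh_le_limit_const2:
  assumes "mesh_converges Nx Ny U W" and "\<And>n. mesh_le Nx Ny (U n) V"
  shows "mesh_le Nx Ny W V"
proof (rule mesh_leI)
  fix \<alpha> i j assume "(i, j) \<in> closed_mesh Nx Ny"
  then show "W \<alpha> i j \<le> V \<alpha> i j"
    using LIMSEQ_le_const2[OF mesh_convergesD[OF assms(1)]] assms(2) by (meson mesh_leD)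
qed

lemma decreasing_mesh_converges:
  assumes "\<And>n. mesh_le Nx Ny (U (Suc n)) (U n)" and "\<And>n. mesh_le Nx Ny V (U n)"
  obtains W where "mesh_converges Nx Ny U W" "\<And>n. mesh_le Nx Ny W (U n)"
proof -
  have dec: "decseq (\<lambda>n. U n \<alpha> i j)" if "(i, j) \<in> closed_mesh Nx Ny" for \<alpha> i j
    using assms(1) that by (intro decseq_SucI) (auto dest: mesh_leD)
  have "\<exists>w. (\<lambda>n. U n \<alpha> i j) \<longlonglongrightarrow> w" if "(i, j) \<in> closed_mesh Nx Ny" for \<alpha> i j
    using decseq_convergent[OF dec[OF that], where B = "V \<alpha> i j"] assms(2) that by (meson mesh_leD)
  \<comment> \<open>Off the closed mesh \<open>lim\<close> may be an unspecified value; mesh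
    convergence and mesh order do not look there.\<close>
  then have conv: "mesh_converges Nx Ny U (\<lambda>\<alpha> i j. lim (\<lambda>n. U n \<alpha> i j))"
    unfolding mesh_converges_def using convergent_LIMSEQ_iff convergent_def by blast
  moreover have "mesh_le Nx Ny (\<lambda>\<alpha> i j. lim (\<lambda>n. U n \<alpha> i j)) (U n)" for n
    using decseq_ge[OF dec mesh_convergesD[OF conv]] by (blast intro: mesh_leI)
  ultimately show ?thesis using that by blast
qed

lemma increasing_mesh_converges:
  assumes "\<And>n. mesh_le Nx Ny (U n) (U (Suc n))" and "\<And>n. mesh_le Nx Ny (U n) V"
  obtains W where "mesh_converges Nx Ny U W" "\<And>n. mesh_le Nx Ny (U n) W"
proof -
  have inc: "incseq (\<lambda>n. U n \<alpha> i j)" if "(i, j) \<in> closed_mesh Nx Ny" for \<alpha> i j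
    using assms(1) that by (intro incseq_SucI) (auto dest: mesh_leD)
  have "\<exists>w. (\<lambda>n. U n \<alpha> i j) \<longlonglongrightarrow> w" if "(i, j) \<in> closed_mesh Nx Ny" for \<alpha> i j
    using incseq_convergent[OF inc[OF that], where B = "V \<alpha> i j"] assms(2) that by (meson mesh_leD)
  then have conv: "mesh_converges Nx Ny U (\<lambda>\<alpha> i j. lim (\<lambda>n. U n \<alpha> i j))"
    unfolding mesh_converges_def using convergent_LIMSEQ_iff convergent_def by blast
  moreover have "mesh_le Nx Ny (U n) (\<lambda>\<alpha> i j. lim (\<lambda>n. U n \<alpha> i j))" for n
    using incseq_le[OF inc mesh_convergesD[OF conv]] by (blast intro: mesh_leI)
  ultimately show ?thesis using that by blast
qed

section \<open>The sweep in pointwise form\<close>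

text \<open>The argument is a single component: the two components are coupled only through
  \<open>f\<close>, which a sweep evaluates at the old iterate, so the system for the new iterate
  splits into one system for each \<open>\<alpha>\<close>.\<close>

definition gs_op ::
  "nat \<Rightarrow> nat \<Rightarrow> (2 \<Rightarrow> real) \<Rightarrow> (2 \<Rightarrow> real \<Rightarrow> real \<Rightarrow> real) \<Rightarrow> mesh_fun \<Rightarrow>
   2 \<Rightarrow> (nat \<Rightarrow> nat \<Rightarrow> real) \<Rightarrow> nat \<Rightarrow> nat \<Rightarrow> real"
where
  "gs_op Nx Ny eps v c \<alpha> W i j =
     (coef_d Nx Ny eps v \<alpha> i j + c \<alpha> i j) * W i j - coef_l Nx Ny eps v \<alpha> i j * W (i - 1) j
     - coef_b Nx Ny eps v \<alpha> i j * W i (j - 1) - coef_t Ny eps \<alpha> i j * W i (j + 1)"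

definition gs_rhs ::
  "nat \<Rightarrow> nat \<Rightarrow> (2 \<Rightarrow> real) \<Rightarrow> (2 \<Rightarrow> real \<Rightarrow> real \<Rightarrow> real ^ 2 \<Rightarrow> real) \<Rightarrow> mesh_fun \<Rightarrow>
   2 \<Rightarrow> mesh_fun \<Rightarrow> nat \<Rightarrow> nat \<Rightarrow> real"
where
  "gs_rhs Nx Ny eps f c \<alpha> U i j =
     coef_r Nx eps \<alpha> i j * U \<alpha> (i + 1) j + c \<alpha> i j * U \<alpha> i j
     - f \<alpha> (node Nx i) (node Ny j) (mesh_val U i j)"

text \<open>The difference quotients are regrouped by neighbour, and the two terms
  \<open>c U\<close> cancel, so \<open>c\<close> is arbitrary here. This makes the solutions of the
  scheme exactly the fixed points of the sweep.\<close>

lemma scheme_lhs_eq: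
  "scheme_lhs Nx Ny eps v f \<alpha> U i j
     = gs_op Nx Ny eps v c \<alpha> (U \<alpha>) i j - gs_rhs Nx Ny eps f c \<alpha> U i j"
  by (simp add: scheme_lhs_def diff_op_def gs_op_def gs_rhs_def coef_d_def coef_l_def coef_r_def
      coef_b_def coef_t_def add_divide_distrib diff_divide_distrib algebra_simps)

locale gs_scheme =
  fixes Nx Ny :: nat
    and eps :: "2 \<Rightarrow> real"
    and v :: "2 \<Rightarrow> real \<Rightarrow> real \<Rightarrow> real"
    and f :: "2 \<Rightarrow> real \<Rightarrow> real \<Rightarrow> real ^ 2 \<Rightarrow> real"
    and g :: "2 \<Rightarrow> real \<Rightarrow> real \<Rightarrow> real"
    and c :: mesh_fun
  assumes mesh: "Nx \<ge> 1" "Ny \<ge> 1"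
    and eps_pos: "eps \<alpha> > 0"
    and v_nonneg: "i \<le> Nx \<Longrightarrow> j \<le> Ny \<Longrightarrow> v \<alpha> (node Nx i) (node Ny j) \<ge> 0"
    and c_nonneg: "i \<le> Nx \<Longrightarrow> j \<le> Ny \<Longrightarrow> c \<alpha> i j \<ge> 0"
begin

abbreviation "P \<equiv> gs_op Nx Ny eps v c"
abbreviation "\<Phi> \<equiv> gs_rhs Nx Ny eps f c"
abbreviation "mle \<equiv> mesh_le Nx Ny"

text \<open>One-sided versions of a sweep. A lower solution is a \<open>sub_step\<close> from
  itself, an upper solution a \<open>super_step\<close> from itself, and an actual sweep is both, so
  a single comparison result serves iterates, solutions and upper or lower solutions alike.\<close>

definition sub_step :: "mesh_fun \<Rightarrow> mesh_fun \<Rightarrow> bool" where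
  "sub_step U U' \<longleftrightarrow>
     (\<forall>\<alpha>. \<forall>(i, j)\<in>interior_mesh Nx Ny. P \<alpha> (U' \<alpha>) i j \<le> \<Phi> \<alpha> U i j) \<and>
     (\<forall>\<alpha>. \<forall>(i, j)\<in>boundary_mesh Nx Ny. U' \<alpha> i j \<le> g \<alpha> (node Nx i) (node Ny j))"

definition super_step :: "mesh_fun \<Rightarrow> mesh_fun \<Rightarrow> bool" where
  "super_step U U' \<longleftrightarrow>
     (\<forall>\<alpha>. \<forall>(i, j)\<in>interior_mesh Nx Ny. P \<alpha> (U' \<alpha>) i j \<ge> \<Phi> \<alpha> U i j) \<and>
     (\<forall>\<alpha>. \<forall>(i, j)\<in>boundary_mesh Nx Ny. U' \<alpha> i j \<ge> g \<alpha> (node Nx i) (node Ny j))"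

definition gs_step :: "mesh_fun \<Rightarrow> mesh_fun \<Rightarrow> bool" where
  "gs_step U U' \<longleftrightarrow>
     (\<forall>\<alpha>. \<forall>(i, j)\<in>interior_mesh Nx Ny. P \<alpha> (U' \<alpha>) i j = \<Phi> \<alpha> U i j) \<and>
     (\<forall>\<alpha>. \<forall>(i, j)\<in>boundary_mesh Nx Ny. U' \<alpha> i j = g \<alpha> (node Nx i) (node Ny j))"

lemma sub_stepD:
  "sub_step U U' \<Longrightarrow> (i, j) \<in> interior_mesh Nx Ny \<Longrightarrow> P \<alpha> (U' \<alpha>) i j \<le> \<Phi> \<alpha> U i j"
  "sub_step U U' \<Longrightarrow> (i, j) \<in> boundary_mesh Nx Ny \<Longrightarrow> U' \<alpha> i j \<le> g \<alpha> (node Nx i) (node Ny j)"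
  by (auto simp: sub_step_def)

lemma super_stepD:
  "super_step U U' \<Longrightarrow> (i, j) \<in> interior_mesh Nx Ny \<Longrightarrow> P \<alpha> (U' \<alpha>) i j \<ge> \<Phi> \<alpha> U i j"
  "super_step U U' \<Longrightarrow> (i, j) \<in> boundary_mesh Nx Ny \<Longrightarrow> U' \<alpha> i j \<ge> g \<alpha> (node Nx i) (node Ny j)"
  by (auto simp: super_step_def)

lemma gs_stepD:
  "gs_step U U' \<Longrightarrow> (i, j) \<in> interior_mesh Nx Ny \<Longrightarrow> P \<alpha> (U' \<alpha>) i j = \<Phi> \<alpha> U i j"
  "gs_step U U' \<Longrightarrow> (i, j) \<in> boundary_mesh Nx Ny \<Longrightarrow> U' \<alpha> i j = g \<alpha> (node Nx i) (node Ny j)"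
  by (auto simp: gs_step_def)

lemma gs_step_iff: "gs_step U U' \<longleftrightarrow> sub_step U U' \<and> super_step U U'"
  unfolding gs_step_def sub_step_def super_step_def by (auto simp: split_beta order.eq_iff)

lemma scheme_solution_iff: "scheme_solution Nx Ny eps v f g U \<longleftrightarrow> gs_step U U"
  by (simp add: scheme_solution_def gs_step_def scheme_lhs_eq[where c = c])

lemma ordered_upper_lower_iff:
  "ordered_upper_lower Nx Ny eps v f g W V \<longleftrightarrow> mle V W \<and> super_step W W \<and> sub_step V V"
  unfolding ordered_upper_lower_def sub_step_def super_step_def scheme_lhs_eq[where c = c]
  by (auto simp: split_beta)

section \<open>Inverse monotonicity and solvability of a sweep\<close>

lemma step_pos: "mesh_step Nx > 0" "mesh_step Ny > 0"
  using mesh by (auto simp: mesh_step_def)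

lemma coef_pos:
  "i \<le> Nx \<Longrightarrow> j \<le> Ny \<Longrightarrow> coef_l Nx Ny eps v \<alpha> i j > 0" "coef_r Nx eps \<alpha> i j > 0"
  "i \<le> Nx \<Longrightarrow> j \<le> Ny \<Longrightarrow> coef_b Nx Ny eps v \<alpha> i j > 0" "coef_t Ny eps \<alpha> i j > 0"
  using step_pos eps_pos[of \<alpha>] v_nonneg[of i j \<alpha>]
  by (auto simp: coef_l_def coef_r_def coef_b_def coef_t_def intro!: add_pos_nonneg)

text \<open>Discrete minimum principle. A negative minimum over the mesh would be interior; bounding
  the three neighbours in \<open>P\<close> below by it would give
  \<open>P \<alpha> W \<le> (r + c) W < 0\<close> there. Strictness comes from \<open>r > 0\<close>:
  the right neighbour contributes to the diagonal \<open>d\<close> but is absent from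
  \<open>P\<close>.\<close>

lemma gs_op_nonneg_imp:
  assumes int: "\<And>i j. (i, j) \<in> interior_mesh Nx Ny \<Longrightarrow> P \<alpha> W i j \<ge> 0"
    and bd: "\<And>i j. (i, j) \<in> boundary_mesh Nx Ny \<Longrightarrow> W i j \<ge> 0"
    and ij: "(i, j) \<in> closed_mesh Nx Ny"
  shows "W i j \<ge> 0"
proof -
  have fin: "finite (closed_mesh Nx Ny)" by (simp add: closed_mesh_def)
  then obtain m where m: "m \<in> closed_mesh Nx Ny"
      and le_m: "\<And>p. p \<in> closed_mesh Nx Ny \<Longrightarrow> case_prod W m \<le> case_prod W p"
    using ij arg_min_if_finite(1) arg_min_least by (metis empty_iff)
  obtain k l where kl: "m = (k, l)" by force
  have "W k l \<ge> 0"
  proof (rule ccontr)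
    assume neg: "\<not> W k l \<ge> 0"
    then have "(k, l) \<in> interior_mesh Nx Ny"
      using m kl bd by (auto elim: closed_mesh_cases)
    then have kl': "0 < k" "k < Nx" "0 < l" "l < Ny" and "P \<alpha> W k l \<ge> 0"
      using int by (auto simp: interior_mesh_iff)
    note pos = coef_pos(1,3)[of k l \<alpha>] coef_pos(2,4)[of \<alpha> k l]
    have "coef_l Nx Ny eps v \<alpha> k l * W (k - 1) l \<ge> coef_l Nx Ny eps v \<alpha> k l * W k l"
      "coef_b Nx Ny eps v \<alpha> k l * W k (l - 1) \<ge> coef_b Nx Ny eps v \<alpha> k l * W k l"
      "coef_t Ny eps \<alpha> k l * W k (l + 1) \<ge> coef_t Ny eps \<alpha> k l * W k l"
      using pos kl' le_m[of "(k - 1, l)"] le_m[of "(k, l - 1)"] le_m[of "(k, l + 1)"] kl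
      by (auto simp: closed_mesh_iff intro!: mult_left_mono)
    \<comment> \<open>Of the diagonal, \<open>d - l - b - t = r\<close> is left over, together with
      \<open>c\<close>.\<close>
    then have "P \<alpha> W k l \<le> (coef_r Nx eps \<alpha> k l + c \<alpha> k l) * W k l"
      by (simp add: gs_op_def coef_d_def algebra_simps)
    also have "\<dots> < 0"
      using pos c_nonneg[of k l \<alpha>] kl' neg by (intro mult_pos_neg) auto
    finally show False using \<open>P \<alpha> W k l \<ge> 0\<close> by simp
  qed
  then show ?thesis using le_m[OF ij] kl by simp
qed

text \<open>\<open>P\<close> is linear, so the minimum principle applies to \<open>W' - V'\<close>
  in each component.\<close>

lemma comparison:
  assumes "sub_step V V'" and "super_step W W'"
    and "\<And>\<alpha> i j. (i, j) \<in> interior_mesh Nx Ny \<Longrightarrow> \<Phi> \<alpha> V i j \<le> \<Phi> \<alpha> W i j"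
  shows "mle V' W'"
proof (rule mesh_leI)
  fix \<alpha> i j assume ij: "(i, j) \<in> closed_mesh Nx Ny"
  have "(\<lambda>i j. W' \<alpha> i j - V' \<alpha> i j) i j \<ge> 0"
  proof (rule gs_op_nonneg_imp[OF _ _ ij, of \<alpha>])
    fix i j assume ij: "(i, j) \<in> interior_mesh Nx Ny"
    have "P \<alpha> (V' \<alpha>) i j \<le> P \<alpha> (W' \<alpha>) i j"
      using sub_stepD(1)[OF assms(1) ij, of \<alpha>] super_stepD(1)[OF assms(2) ij, of \<alpha>]
        assms(3)[OF ij, of \<alpha>] by linarith
    then show "P \<alpha> (\<lambda>i j. W' \<alpha> i j - V' \<alpha> i j) i j \<ge> 0"
      by (simp add: gs_op_def algebra_simps)
  next
    fix i j assume ij: "(i, j) \<in> boundary_mesh Nx Ny"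
    show "W' \<alpha> i j - V' \<alpha> i j \<ge> 0"
      using sub_stepD(2)[OF assms(1) ij, of \<alpha>] super_stepD(2)[OF assms(2) ij, of \<alpha>] by linarith
  qed
  then show "V' \<alpha> i j \<le> W' \<alpha> i j" by simp
qed

text \<open>For each \<open>\<alpha>\<close> the interior values are the unknowns of a diagonally
  dominant system; known boundary values move to the right-hand side.\<close>

lemma gs_step_exists: "\<exists>U'. gs_step U U'"
proof -
  let ?I = "interior_mesh Nx Ny"
  let ?l = "coef_l Nx Ny eps v" and ?b = "coef_b Nx Ny eps v" and ?t = "coef_t Ny eps"
  have fin: "finite ?I" by (simp add: interior_mesh_def)
  have "\<exists>X. (\<forall>(i, j)\<in>?I. P \<alpha> X i j = \<Phi> \<alpha> U i j) \<and>
      (\<forall>(i, j)\<in>boundary_mesh Nx Ny. X i j = g \<alpha> (node Nx i) (node Ny j))" for \<alpha>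
  proof -
    \<comment> \<open>Each row carries its left, lower and upper neighbour. Summation over
      \<open>?I\<close> discards neighbours on the boundary.\<close>
    define a where "a = (\<lambda>(i, j) q. (if q = (i - 1, j) then ?l \<alpha> i j else 0)
      + (if q = (i, j - 1) then ?b \<alpha> i j else 0) + (if q = (i, j + 1) then ?t \<alpha> i j else 0))"
    \<comment> \<open>Boundary data extended by zero to the interior, so that in \<open>y\<close>
      below exactly the boundary neighbours contribute.\<close>
    define B where "B p = (if p \<in> ?I then 0 else g \<alpha> (node Nx (fst p)) (node Ny (snd p)))"
      for p
    have delta: "(\<Sum>q\<in>?I. (if q = p then k else 0) * x q) = k * (if p \<in> ?I then x p else 0)"
      for p k and x :: "nat \<times> nat \<Rightarrow> real"
    proof -
      have "(\<Sum>q\<in>?I. (if q = p then k else 0) * x q) = (\<Sum>q\<in>?I. if q = p then k * x q else 0)"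
        by (rule sum.cong) auto
      then show ?thesis using fin by simp
    qed
    have suma: "(\<Sum>q\<in>?I. a (i, j) q * x q) = ?l \<alpha> i j * (if (i - 1, j) \<in> ?I then x (i - 1, j) else 0)
       + ?b \<alpha> i j * (if (i, j - 1) \<in> ?I then x (i, j - 1) else 0)
       + ?t \<alpha> i j * (if (i, j + 1) \<in> ?I then x (i, j + 1) else 0)" for i j x
      by (simp only: a_def split_conv distrib_right sum.distrib delta)
    have nonneg: "a p q \<ge> 0" if "p \<in> ?I" for p q
    proof (cases p)
      case (Pair i j)
      then show ?thesis
        using that coef_pos(1,3)[of i j \<alpha>] coef_pos(4)[of \<alpha> i j]
        by (auto simp: a_def interior_mesh_iff)
    qed
    define Dg where "Dg = (\<lambda>(i, j). coef_d Nx Ny eps v \<alpha> i j + c \<alpha> i j)"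
    define y where "y = (\<lambda>(i, j). \<Phi> \<alpha> U i j + ?l \<alpha> i j * B (i - 1, j) + ?b \<alpha> i j * B (i, j - 1)
      + ?t \<alpha> i j * B (i, j + 1))"
    \<comment> \<open>A row sum is at most \<open>l + b + t = d - r\<close>, since discarding
      neighbours only lowers it.\<close>
    have dom: "(\<Sum>q\<in>?I. a p q) < Dg p"
      if "p \<in> ?I" for p
    proof -
      obtain i j where p: "p = (i, j)" by force
      with that have "i \<le> Nx" "j \<le> Ny" by (auto simp: interior_mesh_iff)
      then show ?thesis
        using suma[of i j "\<lambda>_. 1"] coef_pos(1,3)[of i j \<alpha>] coef_pos(2,4)[of \<alpha> i j]
          c_nonneg[of i j \<alpha>] p
        by (auto simp: Dg_def coef_d_def)
    qed
    have "\<exists>x. \<forall>p\<in>?I. Dg p * x p = (\<Sum>q\<in>?I. a p q * x q) + y p"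
      by (rule diagonally_dominant_solvable[OF fin]) (erule nonneg, erule dom)
    then obtain x where x: "\<And>p. p \<in> ?I \<Longrightarrow> Dg p * x p = (\<Sum>q\<in>?I. a p q * x q) + y p"
      by blast
    define X where "X i j = (if (i, j) \<in> ?I then x (i, j) else B (i, j))" for i j
    have "P \<alpha> X i j = \<Phi> \<alpha> U i j" if "(i, j) \<in> ?I" for i j
      using x[OF that, unfolded suma] that
      by (auto simp: Dg_def y_def gs_op_def X_def B_def algebra_simps split: if_splits)
    moreover have "X i j = g \<alpha> (node Nx i) (node Ny j)" if "(i, j) \<in> boundary_mesh Nx Ny" for i j
      using that by (auto simp: X_def B_def boundary_mesh_def)
    ultimately show ?thesis by blast
  qed
  then show ?thesis
    unfolding gs_step_def all_conj_distrib[symmetric] by (intro choice allI)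
qed

section \<open>Block equations versus pointwise equations\<close>

lemma mat_diag_line:
  assumes k: "k < Ny - 1"
  shows "(mat_diag (Ny - 1) h *\<^sub>v line Ny W \<alpha> i) $ k = h k * W \<alpha> i (k + 1)"
proof -
  have "(mat_diag (Ny - 1) h *\<^sub>v line Ny W \<alpha> i) $ k
      = (\<Sum>q\<in>{0..<Ny - 1}. (if k = q then h q else 0) * W \<alpha> i (q + 1))"
    using k by (simp add: mat_diag_def line_def scalar_prod_def)
  also have "\<dots> = (\<Sum>q\<in>{0..<Ny - 1}. if q = k then h k * W \<alpha> i (k + 1) else 0)"
    by (intro sum.cong) auto
  also have "\<dots> = h k * W \<alpha> i (k + 1)" using k by simp
  finally show ?thesis .
qed

text \<open>A block covers only \<open>j = 1\<close> to \<open>Ny - 1\<close>, so the first and last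
  rows of \<open>A_block\<close> lack a neighbour; the values on \<open>y = 0\<close> and
  \<open>y = 1\<close> enter through \<open>G_block\<close> instead.\<close>

lemma block_matrices_line:
  assumes k: "k < Ny - 1"
  shows "(A_block Nx Ny eps v \<alpha> i *\<^sub>v line Ny W \<alpha> i) $ k
      = coef_d Nx Ny eps v \<alpha> i (k + 1) * W \<alpha> i (k + 1)
        - (if k = 0 then 0 else coef_b Nx Ny eps v \<alpha> i (k + 1) * W \<alpha> i k)
        - (if k + 1 < Ny - 1 then coef_t Ny eps \<alpha> i (k + 1) * W \<alpha> i (k + 2) else 0)"
    and "(L_block Nx Ny eps v \<alpha> i *\<^sub>v line Ny W \<alpha> i') $ k = coef_l Nx Ny eps v \<alpha> i (k + 1) * W \<alpha> i' (k + 1)"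
    and "(R_block Nx Ny eps \<alpha> i *\<^sub>v line Ny W \<alpha> i') $ k = coef_r Nx eps \<alpha> i (k + 1) * W \<alpha> i' (k + 1)"
    and "(C_block Ny c \<alpha> i *\<^sub>v line Ny W \<alpha> i') $ k = c \<alpha> i (k + 1) * W \<alpha> i' (k + 1)"
proof -
  let ?b = "coef_b Nx Ny eps v \<alpha> i (k + 1)" and ?t = "coef_t Ny eps \<alpha> i (k + 1)"
    and ?d = "coef_d Nx Ny eps v \<alpha> i (k + 1)"
  have "(A_block Nx Ny eps v \<alpha> i *\<^sub>v line Ny W \<alpha> i) $ k
      = (\<Sum>q\<in>{0..<Ny - 1}. (if q = k then ?d else if q + 1 = k then - ?b
          else if q = k + 1 then - ?t else 0) * W \<alpha> i (q + 1))"
    using k by (simp add: A_block_def line_def scalar_prod_def)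
  \<comment> \<open>For \<open>k = 0\<close> truncated subtraction makes \<open>k - 1\<close> equal
    to \<open>k\<close>, hence the inner case distinction.\<close>
  also have "\<dots> = (\<Sum>q\<in>{0..<Ny - 1}. (if q = k then ?d * W \<alpha> i (k + 1) else 0)
      + (if q = k - 1 then if k = 0 then 0 else - ?b * W \<alpha> i k else 0)
      + (if q = k + 1 then - ?t * W \<alpha> i (k + 2) else 0))"
    by (intro sum.cong) auto
  also have "\<dots> = ?d * W \<alpha> i (k + 1) - (if k = 0 then 0 else ?b * W \<alpha> i k)
      - (if k + 1 < Ny - 1 then ?t * W \<alpha> i (k + 2) else 0)"
    using k by (auto simp: sum.distrib)
  finally show "(A_block Nx Ny eps v \<alpha> i *\<^sub>v line Ny W \<alpha> i) $ k = \<dots>" .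
qed (use mat_diag_line[OF k] in \<open>simp_all add: L_block_def R_block_def C_block_def\<close>)

text \<open>Only the iterates \<open>n \<ge> 1\<close> are required to equal \<open>g\<close> on the lines \<open>y = 0, 1\<close>, but the
  residual of \<open>U\<close> takes these values from \<open>g\<close> and never from \<open>U\<close>. Hence the
  equation is uniform in \<open>n\<close>, although the initial iterate may violate the boundary condition.\<close>

lemma block_equation_iff:
  fixes U U' :: mesh_fun
  defines "D \<equiv> (\<lambda>\<alpha> i j. U' \<alpha> i j - U \<alpha> i j)"
  assumes bottom: "U' \<alpha> i 0 = g \<alpha> (node Nx i) (node Ny 0)"
    and top: "U' \<alpha> i Ny = g \<alpha> (node Nx i) (node Ny Ny)"
  shows "A_block Nx Ny eps v \<alpha> i *\<^sub>v line Ny D \<alpha> i - L_block Nx Ny eps v \<alpha> i *\<^sub>v line Ny D \<alpha> (i - 1)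
      + C_block Ny c \<alpha> i *\<^sub>v line Ny D \<alpha> i = - residual Nx Ny eps v f g U \<alpha> i
    \<longleftrightarrow> (\<forall>j\<in>{1..Ny - 1}. P \<alpha> (U' \<alpha>) i j = \<Phi> \<alpha> U i j)"
    (is "?lhs = ?rhs \<longleftrightarrow> _")
proof -
  have nodes: "node Ny 0 = 0" "node Ny Ny = 1"
    using mesh by (auto simp: node_def mesh_step_def)
  have dims: "dim_row (A_block Nx Ny eps v \<alpha> i) = Ny - 1" "dim_row (L_block Nx Ny eps v \<alpha> i) = Ny - 1"
    "dim_row (R_block Nx Ny eps \<alpha> i) = Ny - 1" "dim_row (C_block Ny c \<alpha> i) = Ny - 1"
    "dim_vec (F_block Nx Ny f U \<alpha> i) = Ny - 1" "dim_vec (G_block Nx Ny eps v g \<alpha> i) = Ny - 1"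
    by (simp_all add: A_block_def L_block_def R_block_def C_block_def F_block_def G_block_def
        mat_diag_def)
  have entry: "?lhs $ k = ?rhs $ k \<longleftrightarrow> P \<alpha> (U' \<alpha>) i (k + 1) = \<Phi> \<alpha> U i (k + 1)"
    if k: "k < Ny - 1" for k
  proof -
    note blocks = block_matrices_line[OF k]
    have l: "?lhs $ k = coef_d Nx Ny eps v \<alpha> i (k + 1) * D \<alpha> i (k + 1)
        - (if k = 0 then 0 else coef_b Nx Ny eps v \<alpha> i (k + 1) * D \<alpha> i k)
        - (if k + 1 < Ny - 1 then coef_t Ny eps \<alpha> i (k + 1) * D \<alpha> i (k + 2) else 0)
        - coef_l Nx Ny eps v \<alpha> i (k + 1) * D \<alpha> (i - 1) (k + 1) + c \<alpha> i (k + 1) * D \<alpha> i (k + 1)"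
      using k by (simp add: dims blocks del: index_mult_mat_vec One_nat_def add_Suc_right)
    \<comment> \<open>The boundary contributions are written with \<open>U'\<close> in place of
      \<open>g\<close>. When both sides are compared, the truncated stencil of \<open>U\<close>
      cancels and these terms complete the truncated stencil of \<open>U'\<close>.\<close>
    have r: "?rhs $ k = - (coef_d Nx Ny eps v \<alpha> i (k + 1) * U \<alpha> i (k + 1)
        - (if k = 0 then 0 else coef_b Nx Ny eps v \<alpha> i (k + 1) * U \<alpha> i k)
        - (if k + 1 < Ny - 1 then coef_t Ny eps \<alpha> i (k + 1) * U \<alpha> i (k + 2) else 0)
        - coef_l Nx Ny eps v \<alpha> i (k + 1) * U \<alpha> (i - 1) (k + 1)
        - coef_r Nx eps \<alpha> i (k + 1) * U \<alpha> (i + 1) (k + 1)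
        + f \<alpha> (node Nx i) (node Ny (k + 1)) (mesh_val U i (k + 1))
        - ((if k = 0 then coef_b Nx Ny eps v \<alpha> i (k + 1) * U' \<alpha> i k else 0)
          + (if k + 1 < Ny - 1 then 0 else coef_t Ny eps \<alpha> i (k + 1) * U' \<alpha> i (k + 2))))"
    proof -
      \<comment> \<open>In the last row \<open>k + 2 = Ny\<close>, so the upper neighbour lies on
        \<open>y = 1\<close>, where \<open>top\<close> applies.\<close>
      have "(if k + 1 = Ny - 1 then coef_t Ny eps \<alpha> i (Ny - 1) * g \<alpha> (node Nx i) 1 else 0)
          = (if k + 1 < Ny - 1 then 0 else coef_t Ny eps \<alpha> i (k + 1) * U' \<alpha> i (k + 2))"
      proof (cases "k + 1 = Ny - 1")
        case True
        then have "k + 2 = Ny" using k by simp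
        then show ?thesis using True top by (simp add: nodes)
      qed (use k in auto)
      moreover have "(if k + 1 = 1 then coef_b Nx Ny eps v \<alpha> i 1 * g \<alpha> (node Nx i) 0 else 0)
          = (if k = 0 then coef_b Nx Ny eps v \<alpha> i (k + 1) * U' \<alpha> i k else 0)"
        using bottom by (simp add: nodes)
      ultimately have "G_block Nx Ny eps v g \<alpha> i $ k
          = (if k = 0 then coef_b Nx Ny eps v \<alpha> i (k + 1) * U' \<alpha> i k else 0)
          + (if k + 1 < Ny - 1 then 0 else coef_t Ny eps \<alpha> i (k + 1) * U' \<alpha> i (k + 2))"
        using k unfolding G_block_def by (simp only: index_vec)
      moreover have "F_block Nx Ny f U \<alpha> i $ k
          = f \<alpha> (node Nx i) (node Ny (k + 1)) (mesh_val U i (k + 1))"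
        using k by (simp add: F_block_def)
      ultimately show ?thesis
        using k by (simp add: residual_def dims blocks del: index_mult_mat_vec One_nat_def add_Suc_right)
    qed
    show ?thesis
      unfolding l r by (auto simp: gs_op_def gs_rhs_def D_def algebra_simps)
  qed
  have "dim_vec ?lhs = Ny - 1" "dim_vec ?rhs = Ny - 1"
    by (simp_all add: residual_def dims)
  then have "?lhs = ?rhs \<longleftrightarrow> (\<forall>k<Ny - 1. ?lhs $ k = ?rhs $ k)"
    by (metis eq_vecI)
  also have "\<dots> \<longleftrightarrow> (\<forall>k<Ny - 1. P \<alpha> (U' \<alpha>) i (k + 1) = \<Phi> \<alpha> U i (k + 1))"
    using entry by blast
  also have "\<dots> \<longleftrightarrow> (\<forall>j\<in>{1..Ny - 1}. P \<alpha> (U' \<alpha>) i j = \<Phi> \<alpha> U i j)"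
  proof safe
    fix j assume *: "\<forall>k<Ny - 1. P \<alpha> (U' \<alpha>) i (k + 1) = \<Phi> \<alpha> U i (k + 1)" and "j \<in> {1..Ny - 1}"
    then show "P \<alpha> (U' \<alpha>) i j = \<Phi> \<alpha> U i j" using *[rule_format, of "j - 1"] by auto
  qed auto
  finally show ?thesis .
qed

text \<open>Eliminates the increments: they are forced to be the differences of consecutive
  iterates, and conversely these differences serve as witnesses.\<close>

lemma block_gauss_seidel_iff:
  "block_gauss_seidel Nx Ny eps v f g c U \<longleftrightarrow> (\<forall>n. gs_step (U n) (U (Suc n)))"
proof
  assume "block_gauss_seidel Nx Ny eps v f g c U"
  then obtain Z where Z: "\<forall>n\<ge>1. \<forall>\<alpha>.
        (\<forall>i\<le>Nx. Z n \<alpha> i \<in> carrier_vec (Ny - 1) \<and>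
           line Ny (U n) \<alpha> i = line Ny (U (n - 1)) \<alpha> i + Z n \<alpha> i) \<and>
        (\<forall>i\<in>{1..Nx - 1}.
           A_block Nx Ny eps v \<alpha> i *\<^sub>v Z n \<alpha> i - L_block Nx Ny eps v \<alpha> i *\<^sub>v Z n \<alpha> (i - 1)
             + C_block Ny c \<alpha> i *\<^sub>v Z n \<alpha> i
           = - residual Nx Ny eps v f g (U (n - 1)) \<alpha> i) \<and>
        (\<forall>i\<in>{0, Nx}. Z n \<alpha> i =
           (if n = 1 then g_line Nx Ny g \<alpha> i - line Ny (U 0) \<alpha> i else 0\<^sub>v (Ny - 1))) \<and>
        (\<forall>i\<le>Nx. \<forall>j\<in>{0, Ny}. U n \<alpha> i j = g \<alpha> (node Nx i) (node Ny j))"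
    unfolding block_gauss_seidel_def by (rule exE)
  have carrier: "Z (Suc n) \<alpha> i \<in> carrier_vec (Ny - 1)"
    and update: "line Ny (U (Suc n)) \<alpha> i = line Ny (U n) \<alpha> i + Z (Suc n) \<alpha> i" if "i \<le> Nx" for n \<alpha> i
    using Z[rule_format, of "Suc n" \<alpha>] that by auto
  have eq: "A_block Nx Ny eps v \<alpha> i *\<^sub>v Z (Suc n) \<alpha> i
      - L_block Nx Ny eps v \<alpha> i *\<^sub>v Z (Suc n) \<alpha> (i - 1) + C_block Ny c \<alpha> i *\<^sub>v Z (Suc n) \<alpha> i
      = - residual Nx Ny eps v f g (U n) \<alpha> i" if "i \<in> {1..Nx - 1}" for n \<alpha> i
    using Z[rule_format, of "Suc n" \<alpha>] that by auto
  have Zbd: "Z (Suc n) \<alpha> i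
      = (if n = 0 then g_line Nx Ny g \<alpha> i - line Ny (U 0) \<alpha> i else 0\<^sub>v (Ny - 1))"
    if "i \<in> {0, Nx}" for n \<alpha> i
    using Z[rule_format, of "Suc n" \<alpha>] that by auto
  have hor: "U (Suc n) \<alpha> i j = g \<alpha> (node Nx i) (node Ny j)" if "i \<le> Nx" "j \<in> {0, Ny}" for n \<alpha> i j
    using Z[rule_format, of "Suc n" \<alpha>] that by auto
  \<comment> \<open>The first correction installs \<open>g\<close> on the vertical sides and all
    later corrections vanish there.\<close>
  have vert: "line Ny (U (Suc n)) \<alpha> i = g_line Nx Ny g \<alpha> i" if "i \<in> {0, Nx}" for n \<alpha> i
  proof (induction n)
    case 0
    show ?case using that update[of i 0 \<alpha>] Zbd[OF that, of 0 \<alpha>]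
      by (auto simp: line_def g_line_def)
  next
    case (Suc n)
    then show ?case using that update[of i "Suc n" \<alpha>] Zbd[OF that, of "Suc n" \<alpha>]
      by (auto simp: line_def g_line_def)
  qed
  have bd: "U (Suc n) \<alpha> i j = g \<alpha> (node Nx i) (node Ny j)" if "(i, j) \<in> boundary_mesh Nx Ny"
    for n \<alpha> i j
  \<comment> \<open>The corners belong to the horizontal lines, since block lines omit
    \<open>j = 0\<close> and \<open>j = Ny\<close>.\<close>
  proof (cases "j \<in> {0, Ny}")
    case True
    then show ?thesis using that hor by (auto simp: boundary_mesh_iff)
  next
    case False
    then have i: "i \<in> {0, Nx}" and j: "0 < j" "j - 1 < Ny - 1"
      using that by (auto simp: boundary_mesh_iff)
    have "line Ny (U (Suc n)) \<alpha> i $ (j - 1) = g_line Nx Ny g \<alpha> i $ (j - 1)"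
      using vert[OF i] by simp
    then show ?thesis using j by (simp add: line_def g_line_def)
  qed
  have diff: "Z (Suc n) \<alpha> i = line Ny (\<lambda>\<alpha> i j. U (Suc n) \<alpha> i j - U n \<alpha> i j) \<alpha> i"
    if "i \<le> Nx" for n \<alpha> i
  proof (rule eq_vecI)
    fix k assume "k < dim_vec (line Ny (\<lambda>\<alpha> i j. U (Suc n) \<alpha> i j - U n \<alpha> i j) \<alpha> i)"
    then have k: "k < Ny - 1" by (simp add: line_def)
    then have "line Ny (U (Suc n)) \<alpha> i $ k = line Ny (U n) \<alpha> i $ k + Z (Suc n) \<alpha> i $ k"
      using update[OF that, of n \<alpha>] carrier[OF that, of n \<alpha>] by simp
    then show "Z (Suc n) \<alpha> i $ k = line Ny (\<lambda>\<alpha> i j. U (Suc n) \<alpha> i j - U n \<alpha> i j) \<alpha> i $ k"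
      using k by (simp add: line_def)
  qed (use carrier[OF that, of n \<alpha>] in \<open>simp add: line_def\<close>)
  have "P \<alpha> (U (Suc n) \<alpha>) i j = \<Phi> \<alpha> (U n) i j" if ij: "(i, j) \<in> interior_mesh Nx Ny" for n \<alpha> i j
  proof -
    have i: "i \<in> {1..Nx - 1}" "i \<le> Nx" "i - 1 \<le> Nx" and j: "j \<in> {1..Ny - 1}"
      using ij by (auto simp: interior_mesh_def)
    show ?thesis
      using eq[OF i(1), of \<alpha> n] block_equation_iff[of "U (Suc n)" \<alpha> i "U n"] hor i(2) j
      unfolding diff[OF i(2)] diff[OF i(3)] by simp
  qed
  then show "\<forall>n. gs_step (U n) (U (Suc n))"
    using bd by (auto simp: gs_step_def)
next
  assume step: "\<forall>n. gs_step (U n) (U (Suc n))"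
  have bd: "U (Suc n) \<alpha> i j = g \<alpha> (node Nx i) (node Ny j)" if "(i, j) \<in> boundary_mesh Nx Ny"
    for n \<alpha> i j
    using step that by (auto dest: gs_stepD)
  \<comment> \<open>Truncated subtraction makes \<open>D 0\<close> zero; the method involves only
    the increments with \<open>n \<ge> 1\<close>.\<close>
  define D where "D n = (\<lambda>\<alpha> i j. U n \<alpha> i j - U (n - 1) \<alpha> i j)" for n
  define Z where "Z n = line Ny (D n)" for n
  have line_D: "line Ny (D n) \<alpha> i = line Ny (U n) \<alpha> i - line Ny (U (n - 1)) \<alpha> i" for n \<alpha> i
    by (auto simp: line_def D_def)
  have vert: "line Ny (U (Suc n)) \<alpha> i = g_line Nx Ny g \<alpha> i" if "i \<in> {0, Nx}" for n \<alpha> i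
    using that by (intro eq_vecI) (auto simp: line_def g_line_def bd boundary_mesh_iff)
  have "(\<forall>i\<le>Nx. Z (Suc n) \<alpha> i \<in> carrier_vec (Ny - 1) \<and>
           line Ny (U (Suc n)) \<alpha> i = line Ny (U n) \<alpha> i + Z (Suc n) \<alpha> i) \<and>
        (\<forall>i\<in>{1..Nx - 1}.
           A_block Nx Ny eps v \<alpha> i *\<^sub>v Z (Suc n) \<alpha> i
             - L_block Nx Ny eps v \<alpha> i *\<^sub>v Z (Suc n) \<alpha> (i - 1) + C_block Ny c \<alpha> i *\<^sub>v Z (Suc n) \<alpha> i
           = - residual Nx Ny eps v f g (U n) \<alpha> i) \<and>
        (\<forall>i\<in>{0, Nx}. Z (Suc n) \<alpha> i =
           (if Suc n = 1 then g_line Nx Ny g \<alpha> i - line Ny (U 0) \<alpha> i else 0\<^sub>v (Ny - 1))) \<and>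
        (\<forall>i\<le>Nx. \<forall>j\<in>{0, Ny}. U (Suc n) \<alpha> i j = g \<alpha> (node Nx i) (node Ny j))" for n \<alpha>
  proof (intro conjI allI ballI impI)
    fix i
    show "Z (Suc n) \<alpha> i \<in> carrier_vec (Ny - 1)" by (simp add: Z_def line_def)
    show "line Ny (U (Suc n)) \<alpha> i = line Ny (U n) \<alpha> i + Z (Suc n) \<alpha> i"
      by (auto simp: Z_def line_def D_def)
    show "U (Suc n) \<alpha> i j = g \<alpha> (node Nx i) (node Ny j)" if "i \<le> Nx" "j \<in> {0, Ny}" for j
      using that bd by (auto simp: boundary_mesh_iff)
    \<comment> \<open>After the first sweep both lines in the difference equal
      \<open>g_line\<close>, which gives the zero vector.\<close>
    show "Z (Suc n) \<alpha> i =
        (if Suc n = 1 then g_line Nx Ny g \<alpha> i - line Ny (U 0) \<alpha> i else 0\<^sub>v (Ny - 1))"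
      if "i \<in> {0, Nx}"
      using vert[OF that] by (cases n) (auto simp: Z_def line_D g_line_def)
    show "A_block Nx Ny eps v \<alpha> i *\<^sub>v Z (Suc n) \<alpha> i
        - L_block Nx Ny eps v \<alpha> i *\<^sub>v Z (Suc n) \<alpha> (i - 1) + C_block Ny c \<alpha> i *\<^sub>v Z (Suc n) \<alpha> i
        = - residual Nx Ny eps v f g (U n) \<alpha> i" if i: "i \<in> {1..Nx - 1}"
    proof -
      have "\<forall>j\<in>{1..Ny - 1}. P \<alpha> (U (Suc n) \<alpha>) i j = \<Phi> \<alpha> (U n) i j"
        using i by (simp add: interior_mesh_def gs_stepD(1)[OF step[rule_format]])
      moreover have "(i, 0) \<in> boundary_mesh Nx Ny" "(i, Ny) \<in> boundary_mesh Nx Ny"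
        using i by (auto simp: boundary_mesh_iff)
      ultimately show ?thesis
        using block_equation_iff[of "U (Suc n)" \<alpha> i "U n"] bd by (simp add: Z_def D_def)
    qed
  qed
  then show "block_gauss_seidel Nx Ny eps v f g c U"
    unfolding block_gauss_seidel_def all_ge_one_iff diff_Suc_1 by (intro exI[of _ Z] allI)
qed

lemma block_gauss_seidel_exists: "\<exists>U. U 0 = U0 \<and> block_gauss_seidel Nx Ny eps v f g c U"
proof -
  obtain T where T: "gs_step U (T U)" for U using gs_step_exists by metis
  then have "block_gauss_seidel Nx Ny eps v f g c (\<lambda>n. (T ^^ n) U0)"
    by (simp add: block_gauss_seidel_iff)
  then show ?thesis by (intro exI[of _ "\<lambda>n. (T ^^ n) U0"]) simp
qed

end

section \<open>Monotone iteration in the sector\<close>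

text \<open>\<open>f_mono\<close> is the integrated form of the derivative bounds: it says that
  \<open>c U - f(U)\<close> increases on the sector, which is how they act on the iteration.\<close>

locale gs_monotone = gs_scheme +
  fixes Uup Ulow :: mesh_fun
  assumes upper_lower: "ordered_upper_lower Nx Ny eps v f g Uup Ulow"
    and f_cont: "i \<le> Nx \<Longrightarrow> j \<le> Ny \<Longrightarrow> continuous_on UNIV (f \<alpha> (node Nx i) (node Ny j))"
    and f_mono: "U \<in> sector Nx Ny Ulow Uup \<Longrightarrow> W \<in> sector Nx Ny Ulow Uup \<Longrightarrow> mesh_le Nx Ny U W \<Longrightarrow>
      (i, j) \<in> closed_mesh Nx Ny \<Longrightarrow>
      f \<alpha> (node Nx i) (node Ny j) (mesh_val W i j) - f \<alpha> (node Nx i) (node Ny j) (mesh_val U i j)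
        \<le> c \<alpha> i j * (W \<alpha> i j - U \<alpha> i j)"
begin

abbreviation "Sec \<equiv> sector Nx Ny Ulow Uup"

lemma SecI: "mle Ulow U \<Longrightarrow> mle U Uup \<Longrightarrow> U \<in> Sec"
  and SecD: "U \<in> Sec \<Longrightarrow> mle Ulow U" "U \<in> Sec \<Longrightarrow> mle U Uup"
  by (auto simp: sector_def)

lemma ends: "Ulow \<in> Sec" "Uup \<in> Sec" "sub_step Ulow Ulow" "super_step Uup Uup"
  using upper_lower by (auto simp: sector_def ordered_upper_lower_iff mesh_le_refl)

text \<open>With \<open>r > 0\<close> for the right neighbour and \<open>f_mono\<close> for the
  rest, \<open>\<Phi>\<close> is increasing on the sector, and \<open>comparison\<close> transfers
  the order to the new iterates.\<close>

lemma step_mono: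
  assumes "V \<in> Sec" "W \<in> Sec" "mle V W" "sub_step V V'" "super_step W W'"
  shows "mle V' W'"
proof (rule comparison[OF assms(4,5)])
  fix \<alpha> i j assume "(i, j) \<in> interior_mesh Nx Ny"
  then have ij: "(i, j) \<in> closed_mesh Nx Ny" "(i + 1, j) \<in> closed_mesh Nx Ny"
    by (auto simp: interior_mesh_iff closed_mesh_iff)
  have "coef_r Nx eps \<alpha> i j * V \<alpha> (i + 1) j \<le> coef_r Nx eps \<alpha> i j * W \<alpha> (i + 1) j"
    using mesh_leD[OF assms(3) ij(2)] coef_pos(2)[of \<alpha> i j] by (simp add: mult_left_mono)
  then show "\<Phi> \<alpha> V i j \<le> \<Phi> \<alpha> W i j"
    using f_mono[OF assms(1-3) ij(1), of \<alpha>] by (simp add: gs_rhs_def algebra_simps)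
qed

text \<open>\<open>Ulow\<close> and \<open>Uup\<close> are a sub-step and a super-step from
  themselves, so monotonicity squeezes the new iterate between them.\<close>

lemma gs_step_Sec:
  assumes "U \<in> Sec" "gs_step U U'"
  shows "U' \<in> Sec"
  using step_mono[OF ends(1) assms(1) SecD(1)[OF assms(1)] ends(3)]
    step_mono[OF assms(1) ends(2) SecD(2)[OF assms(1)] _ ends(4)] assms(2)
  by (auto simp: gs_step_iff intro: SecI)

lemma gs_steps_Sec:
  assumes "X 0 \<in> Sec" "\<And>n. gs_step (X n) (X (Suc n))"
  shows "X n \<in> Sec"
  using assms by (induction n) (auto intro: gs_step_Sec)

text \<open>Both sides of the sweep equation are continuous in the finitely many mesh values
  involved, so the limit is a fixed point.\<close>

lemma limit_solution:
  assumes step: "\<And>n. gs_step (X n) (X (Suc n))" and conv: "mesh_converges Nx Ny X L"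
  shows "scheme_solution Nx Ny eps v f g L"
  unfolding scheme_solution_iff gs_step_def
proof (intro conjI allI ballI, safe)
  fix \<alpha> i j assume ij: "(i, j) \<in> interior_mesh Nx Ny"
  then have nb: "(i, j) \<in> closed_mesh Nx Ny" "(i + 1, j) \<in> closed_mesh Nx Ny"
    "(i - 1, j) \<in> closed_mesh Nx Ny" "(i, j + 1) \<in> closed_mesh Nx Ny" "(i, j - 1) \<in> closed_mesh Nx Ny"
    by (auto simp: interior_mesh_iff closed_mesh_iff)
  note lim = mesh_convergesD[OF conv]
  have "(\<lambda>n. P \<alpha> (X n \<alpha>) i j) \<longlonglongrightarrow> P \<alpha> (L \<alpha>) i j"
    unfolding gs_op_def by (intro tendsto_intros lim nb)
  then have "(\<lambda>n. P \<alpha> (X (Suc n) \<alpha>) i j) \<longlonglongrightarrow> P \<alpha> (L \<alpha>) i j"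
    by (rule LIMSEQ_Suc)
  moreover have "(\<lambda>n. mesh_val (X n) i j) \<longlonglongrightarrow> mesh_val L i j"
    unfolding mesh_val_def by (intro tendsto_intros lim nb)
  then have "(\<lambda>n. f \<alpha> (node Nx i) (node Ny j) (mesh_val (X n) i j))
      \<longlonglongrightarrow> f \<alpha> (node Nx i) (node Ny j) (mesh_val L i j)"
    using continuous_on_tendsto_compose[OF f_cont] nb(1) by (auto simp: closed_mesh_iff)
  then have "(\<lambda>n. \<Phi> \<alpha> (X n) i j) \<longlonglongrightarrow> \<Phi> \<alpha> L i j"
    unfolding gs_rhs_def by (intro tendsto_intros lim nb)
  ultimately show "P \<alpha> (L \<alpha>) i j = \<Phi> \<alpha> L i j"
    using gs_stepD(1)[OF step ij, where \<alpha> = \<alpha>] LIMSEQ_unique by simp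
next
  fix \<alpha> i j assume ij: "(i, j) \<in> boundary_mesh Nx Ny"
  \<comment> \<open>The shift skips the initial iterate, whose boundary values may differ from
    \<open>g\<close>.\<close>
  then have "(\<lambda>n. X (Suc n) \<alpha> i j) \<longlonglongrightarrow> L \<alpha> i j"
    by (intro LIMSEQ_Suc mesh_convergesD[OF conv]) (simp add: boundary_mesh_def)
  then show "L \<alpha> i j = g \<alpha> (node Nx i) (node Ny j)"
    using gs_stepD(2)[OF step ij, where \<alpha> = \<alpha>] by (simp add: LIMSEQ_const_iff)
qed

text \<open>A solution in the sector is its own successor and starts below \<open>Uup\<close>, so it
  stays below every iterate and hence below the limit.\<close>

lemma upper_sequence:
  assumes X0: "X 0 = Uup" and "block_gauss_seidel Nx Ny eps v f g c X"
  obtains L where "mesh_converges Nx Ny X L" "L \<in> Sec" "maximal_solution Nx Ny eps v f g Sec L"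
    "\<And>n. mle (X (Suc n)) (X n)" "\<And>n. mle L (X n)"
proof -
  have step: "gs_step (X n) (X (Suc n))" for n
    using assms(2) by (simp add: block_gauss_seidel_iff)
  have Sec: "X n \<in> Sec" for n
    using gs_steps_Sec[of X] step ends(2) X0 by simp
  \<comment> \<open>The first sweep decreases because its result stays in the sector, whose top is
    \<open>X 0\<close>; monotonicity of the step propagates this order.\<close>
  have dec: "mle (X (Suc n)) (X n)" for n
  proof (induction n)
    case 0
    show ?case using SecD(2)[OF Sec] X0 by simp
  next
    case (Suc n)
    then show ?case using step_mono[OF Sec Sec] step by (auto simp: gs_step_iff)
  qed
  obtain L where L: "mesh_converges Nx Ny X L" "\<And>n. mle L (X n)"
    using decreasing_mesh_converges[of Nx Ny X Ulow] dec SecD(1)[OF Sec] by blast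
  have "mle S L" if "S \<in> Sec" "scheme_solution Nx Ny eps v f g S" for S
  proof (rule mesh_le_limit_const[OF L(1)])
    show "mle S (X n)" for n
    proof (induction n)
      case 0
      show ?case using that(1) X0 by (simp add: SecD)
    next
      case (Suc n)
      then show ?case using step_mono[OF that(1) Sec] that(2) step
        by (auto simp: gs_step_iff scheme_solution_iff)
    qed
  qed
  moreover have "L \<in> Sec"
    using mesh_le_limit_const[OF L(1) SecD(1)[OF Sec]] mesh_le_limit_const2[OF L(1) SecD(2)[OF Sec]]
    by (rule SecI)
  ultimately show ?thesis
    using that L dec limit_solution[OF step L(1)] by (auto simp: maximal_solution_def)
qed

text \<open>Mirror image of the upper case, starting at the bottom of the sector.\<close>

lemma lower_sequence:
  assumes X0: "X 0 = Ulow" and "block_gauss_seidel Nx Ny eps v f g c X"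
  obtains L where "mesh_converges Nx Ny X L" "L \<in> Sec" "minimal_solution Nx Ny eps v f g Sec L"
    "\<And>n. mle (X n) (X (Suc n))" "\<And>n. mle (X n) L"
proof -
  have step: "gs_step (X n) (X (Suc n))" for n
    using assms(2) by (simp add: block_gauss_seidel_iff)
  have Sec: "X n \<in> Sec" for n
    using gs_steps_Sec[of X] step ends(1) X0 by simp
  have inc: "mle (X n) (X (Suc n))" for n
  proof (induction n)
    case 0
    show ?case using SecD(1)[OF Sec] X0 by simp
  next
    case (Suc n)
    then show ?case using step_mono[OF Sec Sec] step by (auto simp: gs_step_iff)
  qed
  obtain L where L: "mesh_converges Nx Ny X L" "\<And>n. mle (X n) L"
    using increasing_mesh_converges[of Nx Ny X Uup] inc SecD(2)[OF Sec] by blast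
  have "mle L S" if "S \<in> Sec" "scheme_solution Nx Ny eps v f g S" for S
  proof (rule mesh_le_limit_const2[OF L(1)])
    show "mle (X n) S" for n
    proof (induction n)
      case 0
      show ?case using that(1) X0 by (simp add: SecD)
    next
      case (Suc n)
      then show ?case using step_mono[OF Sec that(1)] that(2) step
        by (auto simp: gs_step_iff scheme_solution_iff)
    qed
  qed
  moreover have "L \<in> Sec"
    using mesh_le_limit_const[OF L(1) SecD(1)[OF Sec]] mesh_le_limit_const2[OF L(1) SecD(2)[OF Sec]]
    by (rule SecI)
  ultimately show ?thesis
    using that L inc limit_solution[OF step L(1)] by (auto simp: minimal_solution_def)
qed

end

section \<open>Convergence of the block iteration to the extremal solutions\<close>

theorem theorem3:
  fixes Nx Ny :: nat
    and eps :: "2 \<Rightarrow> real"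
    and v :: "2 \<Rightarrow> real \<Rightarrow> real \<Rightarrow> real"
    and f :: "2 \<Rightarrow> real \<Rightarrow> real \<Rightarrow> real ^ 2 \<Rightarrow> real"
    and g :: "2 \<Rightarrow> real \<Rightarrow> real \<Rightarrow> real"
    and c Uup Ulow :: mesh_fun
  assumes mesh: "Nx \<ge> 1" "Ny \<ge> 1"
    and eps_pos: "\<And>\<alpha>. eps \<alpha> > 0"
    and v_smooth: "\<And>\<alpha>. smooth_on (closure omega) (\<lambda>(x, y). v \<alpha> x y)"
    and v_nonneg: "\<And>\<alpha> x y. (x, y) \<in> closure omega \<Longrightarrow> v \<alpha> x y \<ge> 0"
    and f_smooth: "\<And>\<alpha>. smooth_on (closure omega \<times> UNIV) (\<lambda>((x, y), u). f \<alpha> x y u)"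
    and g_smooth: "\<And>\<alpha>. smooth_on (frontier omega) (\<lambda>(x, y). g \<alpha> x y)"
    and upper_lower: "ordered_upper_lower Nx Ny eps v f g Uup Ulow"
    and c_nonneg: "\<And>\<alpha> i j. (i, j) \<in> closed_mesh Nx Ny \<Longrightarrow> c \<alpha> i j \<ge> 0"
    and c_bounded: "\<And>\<alpha>. bounded ((\<lambda>(i, j). c \<alpha> i j) ` closed_mesh Nx Ny)"
    and f_diag: "\<And>\<alpha> U i j. U \<in> sector Nx Ny Ulow Uup \<Longrightarrow> (i, j) \<in> closed_mesh Nx Ny \<Longrightarrow>
        partial_deriv (f \<alpha> (node Nx i) (node Ny j)) \<alpha> (mesh_val U i j) \<le> c \<alpha> i j"
    and f_offdiag: "\<And>\<alpha> \<alpha>' U i j. U \<in> sector Nx Ny Ulow Uup \<Longrightarrow> (i, j) \<in> closed_mesh Nx Ny \<Longrightarrow>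
        \<alpha>' \<noteq> \<alpha> \<Longrightarrow>
        - partial_deriv (f \<alpha> (node Nx i) (node Ny j)) \<alpha>' (mesh_val U i j) \<ge> 0"
  shows "(\<exists>Ubar. Ubar 0 = Uup \<and> block_gauss_seidel Nx Ny eps v f g c Ubar) \<and>
    (\<exists>Uund. Uund 0 = Ulow \<and> block_gauss_seidel Nx Ny eps v f g c Uund) \<and>
    (\<forall>Ubar Uund.
       Ubar 0 = Uup \<and> block_gauss_seidel Nx Ny eps v f g c Ubar \<and>
       Uund 0 = Ulow \<and> block_gauss_seidel Nx Ny eps v f g c Uund \<longrightarrow>
       (\<exists>Umax Umin.
          maximal_solution Nx Ny eps v f g (sector Nx Ny Ulow Uup) Umax \<and>
          minimal_solution Nx Ny eps v f g (sector Nx Ny Ulow Uup) Umin \<and>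
          mesh_converges Nx Ny Ubar Umax \<and>
          mesh_converges Nx Ny Uund Umin \<and>
          (\<forall>n\<ge>1. \<forall>\<alpha>. \<forall>i\<le>Nx.
             line Ny (Uund (n - 1)) \<alpha> i \<le> line Ny (Uund n) \<alpha> i \<and>
             line Ny (Uund n) \<alpha> i \<le> line Ny Umin \<alpha> i \<and>
             line Ny Umin \<alpha> i \<le> line Ny Umax \<alpha> i \<and>
             line Ny Umax \<alpha> i \<le> line Ny (Ubar n) \<alpha> i \<and>
             line Ny (Ubar n) \<alpha> i \<le> line Ny (Ubar (n - 1)) \<alpha> i) \<and>
          (\<forall>S\<in>sector Nx Ny Ulow Uup. scheme_solution Nx Ny eps v f g S \<longrightarrow>
             mesh_le Nx Ny Umin S \<and> mesh_le Nx Ny S Umax)))"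
proof -
  have node_closure: "(node Nx i, node Ny j) \<in> closure omega" if "i \<le> Nx" "j \<le> Ny" for i j
    using that node_mem_unit[of i Nx] node_mem_unit[of j Ny] by (simp add: closure_omega)
  have f_diff: "f \<alpha> (node Nx i) (node Ny j) differentiable (at u)" if "i \<le> Nx" "j \<le> Ny" for \<alpha> i j u
    using f_smooth node_closure[OF that] by (rule smooth_on_section)
  \<comment> \<open>The derivative bounds are stated for mesh functions in the sector. Changing
    \<open>Uup\<close> at the single mesh point \<open>(i, j)\<close> realises every vector between
    the bounds there, so they hold throughout the box.\<close>
  have box: "\<exists>V\<in>sector Nx Ny Ulow Uup. mesh_val V i j = p"
    if ij: "(i, j) \<in> closed_mesh Nx Ny"
      and p: "\<And>\<beta>. Ulow \<beta> i j \<le> vec_nth p \<beta> \<and> vec_nth p \<beta> \<le> Uup \<beta> i j" for i j p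
  proof
    let ?V = "\<lambda>\<beta> i' j'. if i' = i \<and> j' = j then vec_nth p \<beta> else Uup \<beta> i' j'"
    show "mesh_val ?V i j = p" by (simp add: mesh_val_def)
    show "?V \<in> sector Nx Ny Ulow Uup"
      using upper_lower p by (auto simp: sector_def mesh_le_def ordered_upper_lower_def)
  qed
  interpret gs_monotone Nx Ny eps v f g c Uup Ulow
  proof
    show "1 \<le> Nx" "1 \<le> Ny" "0 < eps \<alpha>" "ordered_upper_lower Nx Ny eps v f g Uup Ulow" for \<alpha>
      by (fact mesh eps_pos upper_lower)+
    show "0 \<le> v \<alpha> (node Nx i) (node Ny j)" if "i \<le> Nx" "j \<le> Ny" for \<alpha> i j
      using v_nonneg node_closure[OF that] .
    show "0 \<le> c \<alpha> i j" if "i \<le> Nx" "j \<le> Ny" for \<alpha> i j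
      using that c_nonneg by (simp add: closed_mesh_iff)
    show "continuous_on UNIV (f \<alpha> (node Nx i) (node Ny j))" if "i \<le> Nx" "j \<le> Ny" for \<alpha> i j
      using f_diff[OF that]
      by (intro differentiable_imp_continuous_on) (simp add: differentiable_on_def)
  next
    fix U W \<alpha> i j
    assume U: "U \<in> sector Nx Ny Ulow Uup" and W: "W \<in> sector Nx Ny Ulow Uup"
      and le: "mesh_le Nx Ny U W" and ij: "(i, j) \<in> closed_mesh Nx Ny"
    let ?f = "f \<alpha> (node Nx i) (node Ny j)"
    have in_sector: "\<exists>V\<in>sector Nx Ny Ulow Uup. mesh_val V i j = p"
      if "\<And>\<gamma>. vec_nth (mesh_val U i j) \<gamma> \<le> vec_nth p \<gamma> \<and> vec_nth p \<gamma> \<le> vec_nth (mesh_val W i j) \<gamma>"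
      for p
    proof (rule box[OF ij])
      fix \<beta>
      have "Ulow \<beta> i j \<le> U \<beta> i j" "W \<beta> i j \<le> Uup \<beta> i j"
        using U W ij by (auto simp: sector_def dest: mesh_leD)
      then show "Ulow \<beta> i j \<le> vec_nth p \<beta> \<and> vec_nth p \<beta> \<le> Uup \<beta> i j"
        using that[of \<beta>] by (simp add: mesh_val_def)
    qed
    have "?f (mesh_val W i j) - ?f (mesh_val U i j)
        \<le> c \<alpha> i j * (vec_nth (mesh_val W i j) \<alpha> - vec_nth (mesh_val U i j) \<alpha>)"
    proof (rule mono_along_segment)
      show "?f differentiable (at u)" for u
        using ij f_diff by (simp add: closed_mesh_iff)
      show "vec_nth (mesh_val U i j) \<gamma> \<le> vec_nth (mesh_val W i j) \<gamma>" for \<gamma>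
        using mesh_leD[OF le ij] by (simp add: mesh_val_def)
    next
      fix p
      assume "\<And>\<gamma>. vec_nth (mesh_val U i j) \<gamma> \<le> vec_nth p \<gamma> \<and> vec_nth p \<gamma> \<le> vec_nth (mesh_val W i j) \<gamma>"
      from in_sector[OF this] obtain V where V: "V \<in> sector Nx Ny Ulow Uup" "mesh_val V i j = p"
        by blast
      show "partial_deriv ?f \<alpha> p \<le> c \<alpha> i j"
        using f_diag[OF V(1) ij, of \<alpha>] V(2) by simp
      show "partial_deriv ?f \<beta> p \<le> 0" if "\<beta> \<noteq> \<alpha>" for \<beta>
        using f_offdiag[OF V(1) ij that] V(2) by simp
    qed
    then show "?f (mesh_val W i j) - ?f (mesh_val U i j) \<le> c \<alpha> i j * (W \<alpha> i j - U \<alpha> i j)"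
      by (simp add: mesh_val_def)
  qed
  show ?thesis
  proof (intro conjI allI impI block_gauss_seidel_exists, elim conjE)
    fix Ubar Uund
    assume bar: "Ubar 0 = Uup" "block_gauss_seidel Nx Ny eps v f g c Ubar"
      and und: "Uund 0 = Ulow" "block_gauss_seidel Nx Ny eps v f g c Uund"
    obtain Umax where Umax: "mesh_converges Nx Ny Ubar Umax" "Umax \<in> Sec"
        "maximal_solution Nx Ny eps v f g Sec Umax"
        "\<And>n. mle (Ubar (Suc n)) (Ubar n)" "\<And>n. mle Umax (Ubar n)"
      using upper_sequence[OF bar] by blast
    obtain Umin where Umin: "mesh_converges Nx Ny Uund Umin" "Umin \<in> Sec"
        "minimal_solution Nx Ny eps v f g Sec Umin"
        "\<And>n. mle (Uund n) (Uund (Suc n))" "\<And>n. mle (Uund n) Umin"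
      using lower_sequence[OF und] by blast
    \<comment> \<open>\<open>Umax\<close> is itself a solution in the sector, so minimality of
      \<open>Umin\<close> applies to it.\<close>
    have "mle Umin Umax"
      using Umax(2,3) Umin(3) by (simp add: maximal_solution_def minimal_solution_def)
    then have chain: "line Ny (Uund (n - 1)) \<alpha> i \<le> line Ny (Uund n) \<alpha> i \<and>
             line Ny (Uund n) \<alpha> i \<le> line Ny Umin \<alpha> i \<and>
             line Ny Umin \<alpha> i \<le> line Ny Umax \<alpha> i \<and>
             line Ny Umax \<alpha> i \<le> line Ny (Ubar n) \<alpha> i \<and>
             line Ny (Ubar n) \<alpha> i \<le> line Ny (Ubar (n - 1)) \<alpha> i" if "n \<ge> 1" "i \<le> Nx" for n \<alpha> i
      using that Umax(4)[of "n - 1"] Umin(4)[of "n - 1"] Umax(5)[of n] Umin(5)[of n]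
      by (simp add: mesh_le_line)
    show "\<exists>Umax Umin.
          maximal_solution Nx Ny eps v f g (sector Nx Ny Ulow Uup) Umax \<and>
          minimal_solution Nx Ny eps v f g (sector Nx Ny Ulow Uup) Umin \<and>
          mesh_converges Nx Ny Ubar Umax \<and>
          mesh_converges Nx Ny Uund Umin \<and>
          (\<forall>n\<ge>1. \<forall>\<alpha>. \<forall>i\<le>Nx.
             line Ny (Uund (n - 1)) \<alpha> i \<le> line Ny (Uund n) \<alpha> i \<and>
             line Ny (Uund n) \<alpha> i \<le> line Ny Umin \<alpha> i \<and>
             line Ny Umin \<alpha> i \<le> line Ny Umax \<alpha> i \<and>
             line Ny Umax \<alpha> i \<le> line Ny (Ubar n) \<alpha> i \<and>
             line Ny (Ubar n) \<alpha> i \<le> line Ny (Ubar (n - 1)) \<alpha> i) \<and>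
          (\<forall>S\<in>sector Nx Ny Ulow Uup. scheme_solution Nx Ny eps v f g S \<longrightarrow>
             mesh_le Nx Ny Umin S \<and> mesh_le Nx Ny S Umax)"
      using Umax(1,3) Umin(1,3) chain
      by (intro exI[of _ Umax] exI[of _ Umin])
        (simp add: maximal_solution_def minimal_solution_def)
  qed
qed

end
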